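(* Let $X$ be a curve over $\mathbf{F}_{q^\ell}$ ($\ell\ge 1$), let $P_1,\dots,P_n$ be distinct $\mathbf{F}_{q^\ell}$-rational points of $X$, set $D:=P_1+\cdots+P_n$, and let $G$ be a divisor on $X$ whose support avoids that of $D$. Let $G_U$ be the sum of the places $P$ of $X$ such that $v_P(G)\ge 0$ and $v_P(G)\equiv q-1 \pmod q$. Then $$Car_q(D,G)=Car_q(D,G+G_U).$$
   Context: Let $p$ be a prime, $q$ a power of $p$, and $\ell\ge 1$ an integer. A curve is smooth, projective and geometrically irreducible. For a curve $X$ over $\mathbf{F}_{q^\ell}$, $F$ is its function field and $\Omega_{F/\mathbf{F}_{q^\ell}}$ its space of rational differential forms; for a place $P$ and a divisor $A$, $v_P(A)$ denotes the coefficient of $A$ at $P$, and $v_P(\omega)$ is the valuation of a differential form $\omega$ at $P$ (with $v_P(0)=+\infty$). For a divisor $A$ on $X$, $\Omega(A):=H^0(X,\Omega_X\otimes\mathcal{O}_X(-A))=\{\omega\in\Omega_{F/\mathbf{F}_{q^\ell}} : v_P(\omega)\ge v_P(A)\text{ for all places }P\}$. Cartier operator: let $x$ be a separating element of $F/\mathbf{F}_{q^\ell}$. Each $\omega\in\Omega_{F/\mathbf{F}_{q^\ell}}$ can be written $\omega=(f_0^p+f_1^px+\cdots+f_{p-1}^px^{p-1})\,dx$ with $f_i\in F$, and $\mathcal{C}(\omega):=f_{p-1}\,dx$ (independent of the choice of $x$). If $q=p^m$, then $\mathcal{C}_q:=\mathcal{C}^m$ (the $m$-fold iterate), an $\mathbf{F}_q$-linear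 map satisfying $\mathrm{res}_P(\mathcal{C}_q(\omega))=\mathrm{res}_P(\omega)^{1/q}$. For a divisor $G$ whose support avoids that of $D=P_1+\cdots+P_n$, let $\Omega(G-D)^{\mathcal{C}_q}:=\{\omega\in\Omega(G-D):\mathcal{C}_q(\omega)=\omega\}$. The Cartier code is the $\mathbf{F}_q$-linear code $$Car_q(D,G):=\{(\mathrm{res}_{P_1}(\omega),\dots,\mathrm{res}_{P_n}(\omega)) : \omega\in\Omega(G-D)^{\mathcal{C}_q}\}\subseteq\mathbf{F}_q^n.$$ *)

theory Defs
  imports
    "HOL-Computational_Algebra.Polynomial"
    "HOL-Library.Poly_Mapping"
    "HOL-Library.Extended"
    "HOL-Number_Theory.Cong"
begin

section \<open>Function fields of curves\<close>

text \<open>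
  A smooth, projective, geometrically irreducible curve over a finite field \<open>K\<close> is given by its
  function field, the type \<open>'f\<close>, together with the subfield \<open>K\<close> of constants.
\<close>

definition is_subfield :: "'f::field set \<Rightarrow> bool" where
  "is_subfield L \<longleftrightarrow> 0 \<in> L \<and> 1 \<in> L \<and> (\<forall>a\<in>L. \<forall>b\<in>L. a + b \<in> L) \<and> (\<forall>a\<in>L. - a \<in> L) \<and>
     (\<forall>a\<in>L. \<forall>b\<in>L. a * b \<in> L) \<and> (\<forall>a\<in>L. inverse a \<in> L)"

definition poly_over :: "'f::field set \<Rightarrow> 'f poly \<Rightarrow> bool" where
  "poly_over L g \<longleftrightarrow> range (coeff g) \<subseteq> L"

definition algebraic_over :: "'f::field set \<Rightarrow> 'f \<Rightarrow> bool" where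
  "algebraic_over L y \<longleftrightarrow> (\<exists>g. poly_over L g \<and> g \<noteq> 0 \<and> poly g y = 0)"

definition separable_over :: "'f::field set \<Rightarrow> 'f \<Rightarrow> bool" where
  "separable_over L y \<longleftrightarrow> (\<exists>g. poly_over L g \<and> coprime g (pderiv g) \<and> poly g y = 0)"

definition adjoin :: "'f::field set \<Rightarrow> 'f \<Rightarrow> 'f set" where
  "adjoin K x = is_subfield hull (insert x K)"

text \<open>The whole field \<open>'f\<close> is a finite extension of its subfield \<open>L\<close>.\<close>

definition finite_over :: "'f::field set \<Rightarrow> bool" where
  "finite_over L \<longleftrightarrow>
     (\<exists>B. finite B \<and> (\<forall>y. \<exists>c. range c \<subseteq> L \<and> y = (\<Sum>b\<in>B. c b * b)))"

text \<open>
  The last condition (\<open>K\<close> is the full constant field) is geometric irreducibility of the curve,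
  as finite fields are perfect.
\<close>

definition function_field :: "'f::field set \<Rightarrow> bool" where
  "function_field K \<longleftrightarrow> is_subfield K \<and>
     (\<exists>x. \<not> algebraic_over K x \<and> finite_over (adjoin K x)) \<and>
     (\<forall>y. algebraic_over K y \<longrightarrow> y \<in> K)"

definition separating :: "'f::field set \<Rightarrow> 'f \<Rightarrow> bool" where
  "separating K x \<longleftrightarrow>
     finite_over (adjoin K x) \<and> (\<forall>y. separable_over (adjoin K x) y)"


section \<open>Places and divisors\<close>

text \<open>
  The local rings of the curve at its closed points are the discrete valuation rings of \<open>'f\<close>
  containing \<open>K\<close>. A place is identified with the corresponding normalised discrete valuation,
  with values in the integers extended by \<open>v 0 = \<infinity>\<close> (the value \<open>Minf\<close> of the library type never
  occurs).
\<close>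

type_synonym 'f place = "'f \<Rightarrow> int extended"

type_synonym 'f divisor = "'f place \<Rightarrow>\<^sub>0 int"

definition places :: "'f::field set \<Rightarrow> 'f place set" where
  "places K = {v.
     v 0 = \<infinity> \<and>
     (\<forall>x. x \<noteq> 0 \<longrightarrow> v x \<in> range Fin) \<and>
     (\<forall>x y. v (x * y) = v x + v y) \<and>
     (\<forall>x y. min (v x) (v y) \<le> v (x + y)) \<and>
     (\<exists>t. v t = Fin 1) \<and>
     (\<forall>c\<in>K. c \<noteq> 0 \<longrightarrow> v c = Fin 0)}"

text \<open>A place is rational if its residue field is \<open>K\<close>.\<close>

definition rational_places :: "'f::field set \<Rightarrow> 'f place set" where
  "rational_places K =
     {v \<in> places K. \<forall>x. Fin 0 \<le> v x \<longrightarrow> (\<exists>c\<in>K. Fin 0 < v (x - c))}"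

definition divisors :: "'f::field set \<Rightarrow> 'f divisor set" where
  "divisors K = {A. Poly_Mapping.keys A \<subseteq> places K}"

definition divisor_of_places :: "'f place list \<Rightarrow> 'f divisor" where
  "divisor_of_places Ps = (\<Sum>P\<leftarrow>Ps. Poly_Mapping.single P 1)"

text \<open>
  The index set is finite for \<open>q > 1\<close>: since \<open>q - 1\<close> is not divisible by \<open>q\<close>, it is contained in
  the support of \<open>G\<close>.
\<close>

definition upper_divisor :: "'f::field set \<Rightarrow> nat \<Rightarrow> 'f divisor \<Rightarrow> 'f divisor" where
  "upper_divisor K q G =
     (\<Sum>P\<in>{P \<in> places K. 0 \<le> Poly_Mapping.lookup G P \<and>
                [Poly_Mapping.lookup G P = int q - 1] (mod int q)}. Poly_Mapping.single P 1)"


section \<open>Differential forms\<close>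

lemma lookup_map_times:
  "Poly_Mapping.lookup (Poly_Mapping.map ((*) c) a) k = (c::'f::field) * Poly_Mapping.lookup a k"
  by (simp add: map.rep_eq when_def)

text \<open>
  The space of differential forms is the module of Kaehler differentials: the free \<open>'f\<close>-vector
  space on the symbols \<open>dx\<close>, modulo the relations making \<open>d\<close> a \<open>K\<close>-linear derivation
  (\<open>K\<close>-linearity comes from the Leibniz rule and \<open>dc = 0\<close>). The basis vector \<open>dx\<close> of the free
  space is \<open>Poly_Mapping.single x 1\<close>, and a differential form is a coset of the span of the
  relations.
\<close>

global_interpretation kaehler:
  vector_space "\<lambda>c::'f::field. Poly_Mapping.map ((*) c) :: ('f \<Rightarrow>\<^sub>0 'f) \<Rightarrow> ('f \<Rightarrow>\<^sub>0 'f)"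
  by unfold_locales
    (rule poly_mapping_eqI, simp add: lookup_map_times lookup_add distrib_left distrib_right)+

type_synonym 'f differential = "('f \<Rightarrow>\<^sub>0 'f) set"

definition kaehler_relations :: "'f::field set \<Rightarrow> ('f \<Rightarrow>\<^sub>0 'f) set" where
  "kaehler_relations K =
     {Poly_Mapping.single (x + y) 1 - Poly_Mapping.single x 1 - Poly_Mapping.single y 1 | x y. True} \<union>
     {Poly_Mapping.single (x * y) 1 - Poly_Mapping.single y x - Poly_Mapping.single x y | x y. True} \<union>
     {Poly_Mapping.single c 1 | c. c \<in> K}"

definition kaehler_class :: "'f::field set \<Rightarrow> ('f \<Rightarrow>\<^sub>0 'f) \<Rightarrow> 'f differential" where
  "kaehler_class K a = {b. b - a \<in> kaehler.span (kaehler_relations K)}"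

definition differentials :: "'f::field set \<Rightarrow> 'f differential set" where
  "differentials K = range (kaehler_class K)"

text \<open>The differential form \<open>f dx\<close>.\<close>

definition fdiff :: "'f::field set \<Rightarrow> 'f \<Rightarrow> 'f \<Rightarrow> 'f differential" where
  "fdiff K f x = kaehler_class K (Poly_Mapping.single x f)"

text \<open>
  If \<open>t\<close> is a local parameter at \<open>P\<close>, then \<open>dt\<close> is a basis of the differential forms and
  \<open>v\<^sub>P (f dt) = v\<^sub>P f\<close>; the value does not depend on \<open>t\<close>. In particular the zero form has
  valuation \<open>\<infinity>\<close>.
\<close>

definition diff_val :: "'f::field set \<Rightarrow> 'f place \<Rightarrow> 'f differential \<Rightarrow> int extended" where
  "diff_val K P \<omega> = (THE n. \<exists>f t. P t = Fin 1 \<and> \<omega> = fdiff K f t \<and> n = P f)"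

text \<open>
  \<open>laurent_expansion K P t f a\<close>: at the rational place \<open>P\<close> with local parameter \<open>t\<close>, the series
  \<open>\<Sum> a\<^sub>i t\<^sup>i\<close> with coefficients in \<open>K\<close> and finite principal part converges \<open>P\<close>-adically to \<open>f\<close>.
\<close>

definition laurent_expansion ::
  "'f::field set \<Rightarrow> 'f place \<Rightarrow> 'f \<Rightarrow> 'f \<Rightarrow> (int \<Rightarrow> 'f) \<Rightarrow> bool" where
  "laurent_expansion K P t f a \<longleftrightarrow> range a \<subseteq> K \<and>
     (\<exists>k. (\<forall>i<k. a i = 0) \<and> (\<forall>N. Fin N < P (f - (\<Sum>i=k..N. a i * t powi i))))"

text \<open>The residue at a rational place; it does not depend on the local parameter \<open>t\<close>.\<close>

definition residue :: "'f::field set \<Rightarrow> 'f place \<Rightarrow> 'f differential \<Rightarrow> 'f" where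
  "residue K P \<omega> =
     (THE c. \<exists>f t a. P t = Fin 1 \<and> \<omega> = fdiff K f t \<and> laurent_expansion K P t f a \<and> c = a (-1))"

text \<open>The definite description expresses independence of the separating element \<open>x\<close>.\<close>

definition cartier :: "'f::field set \<Rightarrow> nat \<Rightarrow> 'f differential \<Rightarrow> 'f differential" where
  "cartier K p \<omega> =
     (THE \<eta>. \<exists>x f. separating K x \<and> \<omega> = fdiff K (\<Sum>i<p. f i ^ p * x ^ i) x \<and>
                   \<eta> = fdiff K (f (p - 1)) x)"

definition Omega :: "'f::field set \<Rightarrow> 'f divisor \<Rightarrow> 'f differential set" where
  "Omega K A =
     {\<omega> \<in> differentials K. \<forall>P\<in>places K. Fin (Poly_Mapping.lookup A P) \<le> diff_val K P \<omega>}"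


section \<open>Cartier codes\<close>

text \<open>
  For \<open>q = p ^ m\<close>: the code \<open>Car\<^sub>q(D, G)\<close> where \<open>D\<close> is the sum of the places in the list \<open>Ps\<close>.
  Codewords are lists indexed like \<open>Ps\<close>, with entries in the subfield of order \<open>q\<close> of \<open>K\<close>.
\<close>

definition cartier_code ::
  "'f::field set \<Rightarrow> nat \<Rightarrow> nat \<Rightarrow> 'f place list \<Rightarrow> 'f divisor \<Rightarrow> 'f list set" where
  "cartier_code K p m Ps G =
     {map (\<lambda>P. residue K P \<omega>) Ps | \<omega>.
        \<omega> \<in> Omega K (G - divisor_of_places Ps) \<and> (cartier K p ^^ m) \<omega> = \<omega>}"

end

theory Submission
  imports
    Defs
    "HOL-Computational_Algebra.Primes"
    "HOL-Computational_Algebra.Polynomial_Factorial"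
begin

text \<open>
  Let \<open>t\<close> be a local parameter at a place \<open>P\<close> with \<open>n = v\<^sub>P(G) \<ge> 0\<close> and \<open>n \<equiv> q - 1\<close> modulo \<open>q = p\<^sup>m\<close>.
  As the monomials \<open>t\<^sup>i\<close>, \<open>i < p\<close>, have distinct orders modulo \<open>p\<close>, a form \<open>f dt\<close> of order
  \<open>p r + p - 1\<close> has a Cartier image of order exactly \<open>r\<close>. Iterating, a form of order
  \<open>n = q k - 1\<close> has \<open>\<C>\<^sub>q\<close>-image of order \<open>k - 1 < n\<close>, so it is not fixed by \<open>\<C>\<^sub>q\<close>: a fixed form of order at
  least \<open>n\<close> has order at least \<open>n + 1\<close>.

  This needs that \<open>t\<close> is separating with \<open>F = F\<^sup>p(t)\<close>, that \<open>d/dt\<close> identifies the differential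
  forms with \<open>F dt\<close>, and that the Cartier operator computed with \<open>t\<close> agrees with the one computed
  with any other element.
\<close>

section \<open>Subfields and polynomials over them\<close>

locale subfield =
  fixes L :: "'f::field set"
  assumes is_subfield: "is_subfield L"
begin

lemma zero [simp]: "0 \<in> L" and one [simp]: "1 \<in> L"
  and add [intro]: "a \<in> L \<Longrightarrow> b \<in> L \<Longrightarrow> a + b \<in> L"
  and uminus [intro]: "a \<in> L \<Longrightarrow> - a \<in> L"
  and mult [intro]: "a \<in> L \<Longrightarrow> b \<in> L \<Longrightarrow> a * b \<in> L"
  and inv [intro]: "a \<in> L \<Longrightarrow> inverse a \<in> L"
  using is_subfield by (auto simp: is_subfield_def)

lemma diff [intro]: "a \<in> L \<Longrightarrow> b \<in> L \<Longrightarrow> a - b \<in> L"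
  using add[of a "- b"] uminus[of b] by simp

lemma divide [intro]: "a \<in> L \<Longrightarrow> b \<in> L \<Longrightarrow> a / b \<in> L"
  by (simp add: divide_inverse inv mult)

lemma power [intro]: "a \<in> L \<Longrightarrow> a ^ n \<in> L"
  by (induction n) auto

lemma sum [intro]: "(\<And>i. i \<in> I \<Longrightarrow> a i \<in> L) \<Longrightarrow> sum a I \<in> L"
  by (induction I rule: infinite_finite_induct) auto

lemma of_nat [simp]: "of_nat n \<in> L"
  by (induction n) auto

lemma coeff: "poly_over L g \<Longrightarrow> coeff g i \<in> L"
  by (auto simp: poly_over_def)

lemma poly_overI: "(\<And>i. coeff g i \<in> L) \<Longrightarrow> poly_over L g"
  by (auto simp: poly_over_def)

lemma poly_over_0 [simp]: "poly_over L 0" and poly_over_1 [simp]: "poly_over L 1"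
  by (auto intro!: poly_overI simp: coeff_1)

lemma poly_over_add [intro]: "poly_over L g \<Longrightarrow> poly_over L h \<Longrightarrow> poly_over L (g + h)"
  by (auto intro!: poly_overI simp: coeff add diff uminus mult)

lemma poly_over_diff [intro]: "poly_over L g \<Longrightarrow> poly_over L h \<Longrightarrow> poly_over L (g - h)"
  by (auto intro!: poly_overI simp: coeff add diff uminus mult)

lemma poly_over_uminus [intro]: "poly_over L g \<Longrightarrow> poly_over L (- g)"
  by (auto intro!: poly_overI simp: coeff add diff uminus mult)

lemma poly_over_smult [intro]: "a \<in> L \<Longrightarrow> poly_over L g \<Longrightarrow> poly_over L (smult a g)"
  by (auto intro!: poly_overI simp: coeff add diff uminus mult)

lemma poly_over_mult [intro]: "poly_over L g \<Longrightarrow> poly_over L h \<Longrightarrow> poly_over L (g * h)"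
  by (auto intro!: poly_overI simp: coeff add diff uminus mult sum coeff_mult)

lemma poly_over_monom [intro]: "a \<in> L \<Longrightarrow> poly_over L (monom a n)"
  by (auto intro!: poly_overI)

lemma poly_over_pCons [intro]: "a \<in> L \<Longrightarrow> poly_over L g \<Longrightarrow> poly_over L (pCons a g)"
  by (auto intro!: poly_overI simp: coeff add diff uminus mult sum coeff_pCons split: nat.split)

lemma poly_over_X [simp]: "poly_over L [:0, 1:]"
  by (auto intro!: poly_overI simp: coeff_pCons split: nat.split)

lemma poly_over_sum [intro]:
  "(\<And>i. i \<in> I \<Longrightarrow> poly_over L (g i)) \<Longrightarrow> poly_over L (sum g I)"
  by (induction I rule: infinite_finite_induct) auto

lemma poly_over_prod [intro]:
  "(\<And>i. i \<in> I \<Longrightarrow> poly_over L (g i)) \<Longrightarrow> poly_over L (prod g I)"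
  by (induction I rule: infinite_finite_induct) auto

lemma poly_over_pderiv [intro]: "poly_over L g \<Longrightarrow> poly_over L (pderiv g)"
  by (auto intro!: poly_overI simp: coeff add diff uminus mult coeff_pderiv of_nat simp del: of_nat_Suc)

lemma poly_closed: "poly_over L g \<Longrightarrow> y \<in> L \<Longrightarrow> poly g y \<in> L"
  by (auto simp: poly_altdef intro: coeff)

section \<open>Division, common divisors and minimal polynomials over a subfield\<close>

lemma poly_over_division:
  assumes b: "poly_over L b" "b \<noteq> 0" and a: "poly_over L a"
  shows "\<exists>k r. poly_over L k \<and> poly_over L r \<and> a = k * b + r \<and> (r = 0 \<or> degree r < degree b)"
  using a
proof (induction "degree a" arbitrary: a rule: less_induct)
  case less
  show ?case
  proof (cases "a = 0 \<or> degree a < degree b")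
    case True
    then show ?thesis using less.prems by (intro exI[of _ 0] exI[of _ a]) auto
  next
    case False
    \<comment> \<open>The monomial for which \<open>s * b\<close> has the leading term of
      \<open>a\<close>. Its coefficient is a quotient in \<open>L\<close>, so quotient and remainder
      stay over \<open>L\<close>.\<close>
    define s where "s = monom (lead_coeff a / lead_coeff b) (degree a - degree b)"
    have s: "poly_over L s" unfolding s_def using less.prems b by (auto intro: coeff)
    have deg: "a - s * b = 0 \<or> degree (a - s * b) < degree a"
    proof -
      have "lead_coeff a \<noteq> 0" "lead_coeff b \<noteq> 0" using False b by auto
      then have "s \<noteq> 0" and ds: "degree s = degree a - degree b"
        by (auto simp: s_def degree_monom_eq)
      then have d: "degree (s * b) = degree a" using False b by (simp add: degree_mult_eq)
      have "lead_coeff (s * b) = lead_coeff a"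
        using \<open>lead_coeff b \<noteq> 0\<close> ds by (simp add: lead_coeff_mult) (simp add: s_def)
      then have c: "coeff (a - s * b) (degree a) = 0" using d by simp
      have "degree (a - s * b) \<le> degree a" using d by (simp add: degree_diff_le)
      with c show ?thesis
        by (metis eq_zero_or_degree_less)
    qed
    have sab: "poly_over L (a - s * b)" using s b less.prems by auto
    have "\<exists>k r. poly_over L k \<and> poly_over L r \<and> a - s * b = k * b + r \<and> (r = 0 \<or> degree r < degree b)"
    proof (cases "a - s * b = 0")
      case True
      then show ?thesis by (intro exI[of _ 0]) auto
    next
      case False
      then show ?thesis using less.hyps[OF _ sab] deg by auto
    qed
    then obtain k r where k: "poly_over L k" "poly_over L r" "a - s * b = k * b + r"
      "r = 0 \<or> degree r < degree b" by blast
    then have "a = (s + k) * b + r" by (simp add: algebra_simps)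
    then show ?thesis using k s by blast
  qed
qed

text \<open>Euclid's algorithm. The cofactors \<open>a'\<close> and \<open>b'\<close> are recorded
  over \<open>L\<close> too, since a minimal polynomial is irreducible only with respect to factors
  over \<open>L\<close>.\<close>

lemma poly_over_bezout:
  assumes "poly_over L a" "poly_over L b"
  shows "\<exists>h u w a' b'. poly_over L h \<and> poly_over L u \<and> poly_over L w \<and> poly_over L a' \<and>
    poly_over L b' \<and> h = u * a + w * b \<and> a = h * a' \<and> b = h * b'"
  using assms
\<comment> \<open>The measure separates \<open>b = 0\<close> from a nonzero constant
  \<open>b\<close>, both of degree 0.\<close>
proof (induction "if b = 0 then 0 else Suc (degree b)" arbitrary: a b rule: less_induct)
  case less
  show ?case
  proof (cases "b = 0")
    case True
    then show ?thesis using less.prems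
      by (intro exI[of _ a] exI[of _ 1] exI[of _ 0] exI[of _ "1::'f poly"] exI[of _ "0::'f poly"]) auto
  next
    case False
    obtain k r where k: "poly_over L k" "poly_over L r" "a = k * b + r" "r = 0 \<or> degree r < degree b"
      using poly_over_division[OF less.prems(2) False less.prems(1)] by blast
    have "\<exists>h u w a' b'. poly_over L h \<and> poly_over L u \<and> poly_over L w \<and> poly_over L a' \<and>
      poly_over L b' \<and> h = u * b + w * r \<and> b = h * a' \<and> r = h * b'"
      using k False less.prems by (intro less.hyps) auto
    then obtain h u w a' b' where h: "poly_over L h" "poly_over L u" "poly_over L w" "poly_over L a'"
      "poly_over L b'" "h = u * b + w * r" "b = h * a'" "r = h * b'" by blast
    have "h = w * a + (u - w * k) * b" unfolding k(3) h(6) by (simp add: algebra_simps)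
    moreover have "a = h * (k * a' + b')"
      using k(3) by (simp only: h(7) h(8) distrib_left mult.left_commute)
    moreover have "poly_over L (u - w * k)" "poly_over L (k * a' + b')"
      using h(1-5) k(1,2) by auto
    ultimately show ?thesis using h(1,3,4,7) by blast
  qed
qed

lemma minimal_poly:
  assumes "algebraic_over L y"
  obtains g where "poly_over L g" "g \<noteq> 0" "poly g y = 0"
    "\<And>h. poly_over L h \<Longrightarrow> h \<noteq> 0 \<Longrightarrow> poly h y = 0 \<Longrightarrow> degree g \<le> degree h"
proof -
  obtain g where "poly_over L g \<and> g \<noteq> 0 \<and> poly g y = 0"
    using assms by (auto simp: algebraic_over_def)
  from ex_has_least_nat[of "\<lambda>g. poly_over L g \<and> g \<noteq> 0 \<and> poly g y = 0" g degree, OF this]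
  show thesis using that by blast
qed

text \<open>Irreducibility of a minimal polynomial: \<open>y\<close> is a root of one factor, which
  by minimality has the full degree, and degrees add.\<close>

lemma minimal_poly_mult:
  assumes "poly_over L g" "g \<noteq> 0" "poly g y = 0"
    and min: "\<And>h. poly_over L h \<Longrightarrow> h \<noteq> 0 \<Longrightarrow> poly h y = 0 \<Longrightarrow> degree g \<le> degree h"
    and h: "poly_over L h" "poly_over L k" "g = h * k"
  shows "degree h = 0 \<or> degree k = 0"
proof -
  have nz: "h \<noteq> 0" "k \<noteq> 0" using assms by auto
  then have d: "degree g = degree h + degree k" using h by (simp add: degree_mult_eq)
  have "poly h y = 0 \<or> poly k y = 0" using assms by simp
  then show ?thesis using min[of h] min[of k] nz h d by auto
qed

text \<open>Only inverses need an idea. If \<open>poly a x\<close> is nonzero, the gcd of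
  \<open>a\<close> and the minimal polynomial of \<open>x\<close> does not vanish at
  \<open>x\<close>, so irreducibility makes it constant; the Bezout relation at \<open>x\<close>
  then inverts \<open>poly a x\<close>.\<close>

lemma algebraic_ring_is_field:
  assumes "algebraic_over L x"
  shows "is_subfield {poly g x | g. poly_over L g}" (is "is_subfield ?E")
proof -
  define E where "E = ?E"
  have I: "poly g x \<in> E" if "poly_over L g" for g
    unfolding E_def using that by blast
  have 0: "0 \<in> E" using I[of 0] by simp
  have 1: "1 \<in> E" using I[of 1] by simp
  have 2: "poly a x + poly b x \<in> E" if "poly_over L a" "poly_over L b" for a b
    using I[of "a + b"] that poly_over_add by simp
  have 3: "- poly a x \<in> E" if "poly_over L a" for a
    using I[of "- a"] that poly_over_uminus by simp
  have 4: "poly a x * poly b x \<in> E" if "poly_over L a" "poly_over L b" for a b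
    using I[of "a * b"] that poly_over_mult by simp
  have 5: "inverse (poly a x) \<in> E" if a: "poly_over L a" for a
  proof (cases "poly a x = 0")
    case True then show ?thesis using 0 by simp
  next
    case False
    obtain g where g: "poly_over L g" "g \<noteq> 0" "poly g x = 0"
      "\<And>h. poly_over L h \<Longrightarrow> h \<noteq> 0 \<Longrightarrow> poly h x = 0 \<Longrightarrow> degree g \<le> degree h"
      using minimal_poly[OF assms] by blast
    obtain h u w a' g' where h: "poly_over L h" "poly_over L u" "poly_over L w" "poly_over L a'"
      "poly_over L g'" "h = u * a + w * g" "a = h * a'" "g = h * g'"
      using poly_over_bezout[OF a g(1)] by blast
    have "poly h x \<noteq> 0" using False unfolding h(7) by auto
    then have "poly g' x = 0" using g(3) unfolding h(8) by simp
    moreover have "g' \<noteq> 0" using g(2) unfolding h(8) by auto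
    ultimately have "degree g' \<noteq> 0"
      by (metis degree_eq_zeroE pCons_0_0 poly_0 poly_pCons add_0_right mult_zero_right)
    moreover have "degree h = 0 \<or> degree g' = 0"
      by (rule minimal_poly_mult[OF g(1-3) _ h(1) h(5) h(8)]) (rule g(4))
    ultimately have "degree h = 0" by simp
    then obtain c where c: "h = [:c:]" by (rule degree_eq_zeroE)
    then have "c \<in> L" using h(1) coeff[of h 0] by simp
    have "c \<noteq> 0" using c \<open>poly h x \<noteq> 0\<close> by simp
    have "poly h x = poly u x * poly a x" unfolding h(6) using g(3) by simp
    then have "poly u x * poly a x = c" using c by simp
    then have "inverse (poly a x) = poly (smult (inverse c) u) x"
      using \<open>c \<noteq> 0\<close> False by (simp add: field_simps)
    moreover have "poly_over L (smult (inverse c) u)" using \<open>c \<in> L\<close> h(2) by auto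
    ultimately show ?thesis using I by metis
  qed
  have E: thesis if "y \<in> E" and "\<And>g. y = poly g x \<Longrightarrow> poly_over L g \<Longrightarrow> thesis"
    for y thesis using that unfolding E_def by blast
  show ?thesis unfolding is_subfield_def E_def[symmetric]
  proof (intro conjI ballI)
    show "a + b \<in> E" if "a \<in> E" "b \<in> E" for a b using that by (auto elim!: E intro: 2)
    show "- a \<in> E" if "a \<in> E" for a using that by (auto elim!: E intro: 3)
    show "a * b \<in> E" if "a \<in> E" "b \<in> E" for a b using that by (auto elim!: E intro: 4)
    show "inverse a \<in> E" if "a \<in> E" for a using that by (auto elim!: E intro: 5)
  qed (rule 0 1)+
qed

section \<open>Linear dependence and finite extensions\<close>

text \<open>Gaussian elimination of one spanning vector at a time. The vectors form an indexed
  family, so that repeated values, such as equal powers of an element, count separately.\<close>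

lemma steinitz:
  assumes "finite B" "finite I" "card B < card I"
    and "\<And>i. i \<in> I \<Longrightarrow> \<exists>c. range c \<subseteq> L \<and> z i = (\<Sum>b\<in>B. c b * b)"
  shows "\<exists>c. range c \<subseteq> L \<and> (\<exists>i\<in>I. c i \<noteq> 0) \<and> (\<Sum>i\<in>I. c i * z i) = 0"
  using assms
proof (induction B arbitrary: I z rule: finite_induct)
  case empty
  then obtain j where "j \<in> I" by fastforce
  have "\<forall>i\<in>I. z i = 0" using empty by auto
  then show ?case using \<open>j \<in> I\<close> by (intro exI[of _ "\<lambda>_. 1"]) auto
next
  case (insert b B)
  have "\<forall>i\<in>I. \<exists>c. range c \<subseteq> L \<and> z i = (\<Sum>b'\<in>insert b B. c b' * b')"
    using insert.prems by blast
  then obtain c where c: "\<And>i. i \<in> I \<Longrightarrow> range (c i) \<subseteq> L"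
    "\<And>i. i \<in> I \<Longrightarrow> z i = (\<Sum>b'\<in>insert b B. c i b' * b')" by metis
  then have z: "z i = c i b * b + (\<Sum>b'\<in>B. c i b' * b')" if "i \<in> I" for i
    using insert.hyps that by simp
  show ?case
  proof (cases "\<forall>i\<in>I. c i b = 0")
    case True
    then have "range (c i) \<subseteq> L \<and> z i = (\<Sum>b'\<in>B. c i b' * b')" if "i \<in> I" for i
      using z[OF that] c(1)[OF that] that by simp
    moreover have "card B < card I" using insert.prems insert.hyps by simp
    ultimately show ?thesis using insert.prems(1) by (intro insert.IH) blast+
  next
    case False
    then obtain j where j: "j \<in> I" "c j b \<noteq> 0" by blast
    \<comment> \<open>The multiple of \<open>z j\<close> that removes \<open>b\<close> from
      \<open>z i\<close>.\<close>
    define r where "r i = c i b / c j b" for i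
    have r: "r i \<in> L" if "i \<in> I" for i using c(1)[OF that] c(1)[OF j(1)] unfolding r_def by (intro divide) blast+
    have "\<exists>e. range e \<subseteq> L \<and> (\<exists>i\<in>I - {j}. e i \<noteq> 0) \<and> (\<Sum>i\<in>I - {j}. e i * (z i - r i * z j)) = 0"
    proof (rule insert.IH)
      show "card B < card (I - {j})" using insert j by simp
      fix i assume i: "i \<in> I - {j}"
      have "z i - r i * z j = (\<Sum>b'\<in>B. (c i b' - r i * c j b') * b')"
        using i j z[of i] z[of j]
        by (simp add: r_def algebra_simps sum_subtractf sum_distrib_left)
      moreover have "range (\<lambda>b'. c i b' - r i * c j b') \<subseteq> L" using c(1) r i j by blast
      ultimately show "\<exists>e. range e \<subseteq> L \<and> z i - r i * z j = (\<Sum>b\<in>B. e b * b)" by blast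
    qed (use insert in auto)
    then obtain e where e: "range e \<subseteq> L" "\<exists>i\<in>I - {j}. e i \<noteq> 0"
      "(\<Sum>i\<in>I - {j}. e i * (z i - r i * z j)) = 0" by blast
    \<comment> \<open>The coefficient at \<open>j\<close> collects the multiples of
      \<open>z j\<close> subtracted from the other vectors.\<close>
    define e' where "e' = e(j := - (\<Sum>i\<in>I - {j}. e i * r i))"
    have "(\<Sum>i\<in>I. e' i * z i) = e' j * z j + (\<Sum>i\<in>I - {j}. e' i * z i)"
      using j insert.prems by (simp add: sum.remove)
    also have "(\<Sum>i\<in>I - {j}. e' i * z i) = (\<Sum>i\<in>I - {j}. e i * z i)"
      by (rule sum.cong) (auto simp: e'_def)
    also have "e' j * z j + \<dots> = (\<Sum>i\<in>I - {j}. e i * (z i - r i * z j))"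
      by (simp add: e'_def sum_distrib_left sum_distrib_right algebra_simps sum_subtractf)
    finally have "(\<Sum>i\<in>I. e' i * z i) = 0" using e(3) by simp
    moreover have "- (\<Sum>i\<in>I - {j}. e i * r i) \<in> L" using e(1) r by (intro uminus sum mult) blast+
    then have "range e' \<subseteq> L" using e(1) by (auto simp: e'_def)
    moreover have "\<exists>i\<in>I. e' i \<noteq> 0" using e(2) by (auto simp: e'_def)
    ultimately show ?thesis by blast
  qed
qed

text \<open>\<open>finite_over\<close> asks for a set of generators; for a family, the coefficients
  of coinciding generators are added.\<close>

lemma finite_overI:
  assumes "finite I" and "\<And>y. \<exists>c. range c \<subseteq> L \<and> y = (\<Sum>i\<in>I. c i * z i)"
  shows "finite_over L"
  unfolding finite_over_def
proof (intro exI[of _ "z ` I"] conjI allI)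
  fix y
  obtain c where c: "range c \<subseteq> L" "y = (\<Sum>i\<in>I. c i * z i)" using assms(2) by blast
  have "y = (\<Sum>b\<in>z ` I. \<Sum>i\<in>{i\<in>I. z i = b}. c i * z i)"
    using c(2) sum.image_gen[OF assms(1)] by blast
  also have "\<dots> = (\<Sum>b\<in>z ` I. (\<Sum>i\<in>{i\<in>I. z i = b}. c i) * b)"
    by (auto simp: sum_distrib_right intro!: sum.cong)
  finally show "\<exists>c. range c \<subseteq> L \<and> y = (\<Sum>b\<in>z ` I. c b * b)"
    using c(1) by (intro exI[of _ "\<lambda>b. \<Sum>i\<in>{i\<in>I. z i = b}. c i"]) auto
qed (use assms in simp)

text \<open>The powers of \<open>y\<close> with exponents 0 to \<open>card B\<close> outnumber the
  generators, so they are dependent.\<close>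

lemma finite_over_imp_algebraic:
  assumes "finite_over L"
  shows "algebraic_over L y"
proof -
  obtain B where B: "finite B" "\<forall>y. \<exists>c. range c \<subseteq> L \<and> y = (\<Sum>b\<in>B. c b * b)"
    using assms by (auto simp: finite_over_def)
  obtain c where c: "range c \<subseteq> L" "\<exists>i\<in>{..card B}. c i \<noteq> 0" "(\<Sum>i\<le>card B. c i * y ^ i) = 0"
    using steinitz[of B "{..card B}" "\<lambda>i. y ^ i"] B by auto
  let ?g = "\<Sum>i\<le>card B. monom (c i) i"
  have "poly_over L ?g" using c(1) by (intro poly_over_sum poly_over_monom) blast
  moreover have "coeff ?g i = c i" if "i \<le> card B" for i
    using that by (simp add: coeff_sum)
  then have "?g \<noteq> 0" using c(2) by (metis atMost_iff coeff_0)
  moreover have "poly ?g y = 0" using c(3) by (simp add: poly_sum poly_monom)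
  ultimately show ?thesis unfolding algebraic_over_def by blast
qed

section \<open>Simple extensions and exchange of generators\<close>

lemma is_subfield_fractions:
  "is_subfield {poly a x / poly b x | a b. poly_over L a \<and> poly_over L b \<and> poly b x \<noteq> 0}"
  (is "is_subfield ?E")
proof -
  define E where "E = ?E"
  have I: "poly a x / poly b x \<in> E" if "poly_over L a" "poly_over L b" "poly b x \<noteq> 0" for a b
    unfolding E_def using that by blast
  have 0: "0 \<in> E" using I[of 0 1] by simp
  have 1: "1 \<in> E" using I[of 1 1] by simp
  have 2: "poly a x / poly b x + poly c x / poly d x \<in> E"
    if "poly_over L a" "poly_over L b" "poly b x \<noteq> 0" "poly_over L c" "poly_over L d" "poly d x \<noteq> 0"
    for a b c d
    using I[of "a * d + c * b" "b * d"] that poly_over_add poly_over_mult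
    by (simp add: add_frac_eq)
  have 3: "- (poly a x / poly b x) \<in> E" if "poly_over L a" "poly_over L b" "poly b x \<noteq> 0" for a b
    using I[of "- a" b] that poly_over_uminus by simp
  have 4: "(poly a x / poly b x) * (poly c x / poly d x) \<in> E"
    if "poly_over L a" "poly_over L b" "poly b x \<noteq> 0" "poly_over L c" "poly_over L d" "poly d x \<noteq> 0"
    for a b c d
    using I[of "a * c" "b * d"] that poly_over_mult by simp
  have 5: "inverse (poly a x / poly b x) \<in> E" if "poly_over L a" "poly_over L b" "poly b x \<noteq> 0" for a b
    using I[of b a] that 0 by (cases "poly a x = 0") simp_all
  have E: thesis if "y \<in> E" and "\<And>a b. y = poly a x / poly b x \<Longrightarrow> poly_over L a \<Longrightarrow>
      poly_over L b \<Longrightarrow> poly b x \<noteq> 0 \<Longrightarrow> thesis"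
    for y thesis using that unfolding E_def by blast
  show ?thesis unfolding is_subfield_def E_def[symmetric]
  proof (intro conjI ballI)
    show "a + b \<in> E" if "a \<in> E" "b \<in> E" for a b using that by (auto elim!: E intro: 2)
    show "- a \<in> E" if "a \<in> E" for a using that by (auto elim!: E intro: 3)
    show "a * b \<in> E" if "a \<in> E" "b \<in> E" for a b using that by (auto elim!: E intro: 4)
    show "inverse a \<in> E" if "a \<in> E" for a using that by (auto elim!: E intro: 5)
  qed (rule 0 1)+
qed

lemma is_subfield_Inter: "(\<And>E. E \<in> S \<Longrightarrow> is_subfield E) \<Longrightarrow> is_subfield (\<Inter> S)"
  unfolding is_subfield_def by (intro conjI ballI InterI; simp)

lemma is_subfield_adjoin: "is_subfield (adjoin L x)"
  unfolding adjoin_def by (rule hull_in) (rule is_subfield_Inter, blast)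

lemma adjoin_minimal: "is_subfield E \<Longrightarrow> L \<subseteq> E \<Longrightarrow> x \<in> E \<Longrightarrow> adjoin L x \<subseteq> E"
  unfolding adjoin_def by (intro hull_minimal) auto

lemma subset_adjoin: "L \<subseteq> adjoin L x" and generator_in_adjoin: "x \<in> adjoin L x"
  using hull_subset[of "insert x L" is_subfield] by (auto simp: adjoin_def)

lemma adjoin_fraction:
  assumes "y \<in> adjoin L x"
  obtains a b where "poly_over L a" "poly_over L b" "poly b x \<noteq> 0" "y = poly a x / poly b x"
proof -
  let ?E = "{poly a x / poly b x | a b. poly_over L a \<and> poly_over L b \<and> poly b x \<noteq> 0}"
  have "c \<in> ?E" if "c \<in> L" for c
    using that poly_over_pCons[of c 0]
    by (intro CollectI exI[of _ "[:c:]"] exI[of _ 1]) auto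
  moreover have "x \<in> ?E"
    by (intro CollectI exI[of _ "[:0, 1:]"] exI[of _ 1]) simp
  ultimately have "adjoin L x \<subseteq> ?E" using is_subfield_fractions by (intro adjoin_minimal) auto
  then show thesis using assms that by blast
qed

lemma common_denominator:
  assumes "finite I" and "\<And>i. i \<in> I \<Longrightarrow> c i \<in> adjoin L x"
  obtains d g where "d \<noteq> 0" "\<And>i. i \<in> I \<Longrightarrow> poly_over L (g i)" "\<And>i. i \<in> I \<Longrightarrow> poly (g i) x = d * c i"
proof -
  have "\<forall>i\<in>I. \<exists>a b. poly_over L a \<and> poly_over L b \<and> poly b x \<noteq> 0 \<and> c i = poly a x / poly b x"
    using adjoin_fraction assms(2) by metis
  then obtain a b where ab: "\<And>i. i \<in> I \<Longrightarrow> poly_over L (a i)" "\<And>i. i \<in> I \<Longrightarrow> poly_over L (b i)"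
    "\<And>i. i \<in> I \<Longrightarrow> poly (b i) x \<noteq> 0" "\<And>i. i \<in> I \<Longrightarrow> c i = poly (a i) x / poly (b i) x" by metis
  show thesis
  proof (rule that[of "\<Prod>i\<in>I. poly (b i) x" "\<lambda>i. a i * prod b (I - {i})"])
    show "(\<Prod>i\<in>I. poly (b i) x) \<noteq> 0" using ab assms by simp
    fix i assume i: "i \<in> I"
    show "poly_over L (a i * prod b (I - {i}))" using ab i by auto
    have "(\<Prod>i\<in>I. poly (b i) x) = poly (b i) x * (\<Prod>i\<in>I - {i}. poly (b i) x)"
      using i assms by (simp add: prod.remove)
    then show "poly (a i * prod b (I - {i})) x = (\<Prod>i\<in>I. poly (b i) x) * c i"
      using ab i by (simp add: poly_prod)
  qed
qed

text \<open>
  Steinitz exchange: clearing denominators in an equation for \<open>t\<close> over \<open>L(x)\<close> gives a polynomial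
  relation between \<open>t\<close> and \<open>x\<close>, which is an equation for \<open>x\<close> over \<open>L(t)\<close>.
\<close>

lemma algebraic_over_exchange:
  assumes "algebraic_over (adjoin L x) t" "\<not> algebraic_over L t"
  shows "algebraic_over (adjoin L t) x"
proof -
  interpret Lx: subfield "adjoin L x" using is_subfield_adjoin by unfold_locales
  interpret Lt: subfield "adjoin L t" using is_subfield_adjoin by unfold_locales
  obtain f where f: "poly_over (adjoin L x) f" "f \<noteq> 0" "poly f t = 0"
    using assms(1) by (auto simp: algebraic_over_def)
  let ?n = "degree f"
  obtain d g where d: "d \<noteq> 0" and g: "\<And>i. i \<le> ?n \<Longrightarrow> poly_over L (g i)"
    "\<And>i. i \<le> ?n \<Longrightarrow> poly (g i) x = d * coeff f i"
    using common_denominator[of "{..?n}" "coeff f" x] Lx.coeff[OF f(1)] by auto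
  \<comment> \<open>A common degree bound lets all \<open>poly (g i) x\<close> be sums over one
    range, so that the two summations can be swapped.\<close>
  define N where "N = Max ((degree \<circ> g) ` {..?n})"
  have N: "degree (g i) \<le> N" if "i \<le> ?n" for i using that unfolding N_def by (intro Max_ge) auto
  have gx: "poly (g i) x = (\<Sum>j\<le>N. coeff (g i) j * x ^ j)" if "i \<le> ?n" for i
    unfolding poly_altdef using N[OF that]
    by (intro sum.mono_neutral_left) (auto simp: coeff_eq_0)
  \<comment> \<open>The cleared equation is a polynomial in \<open>t\<close> and \<open>x\<close>;
    \<open>h j\<close> is the coefficient of \<open>x ^ j\<close> in it.\<close>
  define h where "h j = (\<Sum>i\<le>?n. monom (coeff (g i) j) i)" for j
  have h: "poly_over L (h j)" for j unfolding h_def using g(1) by (auto intro!: poly_over_sum intro: coeff)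
  have ch: "coeff (h j) i = coeff (g i) j" if "i \<le> ?n" for i j
    using that by (simp add: h_def coeff_sum)
  define H where "H = (\<Sum>j\<le>N. monom (poly (h j) t) j)"
  have cH: "coeff H j = poly (h j) t" if "j \<le> N" for j using that by (simp add: H_def coeff_sum)
  have "poly (h j) t \<in> adjoin L t" for j
    using Lt.poly_closed[of "h j" t] h subset_adjoin generator_in_adjoin
    by (auto simp: poly_over_def)
  then have "poly_over (adjoin L t) H" unfolding H_def by auto
  moreover have "H \<noteq> 0"
  proof -
    \<comment> \<open>The leading coefficient of \<open>f\<close> makes some \<open>h j\<close>
      nonzero, and its value at the transcendental \<open>t\<close> is nonzero too.\<close>
    have "d * lead_coeff f \<noteq> 0" using d f by simp
    then have "g ?n \<noteq> 0" using g(2)[of ?n] by auto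
    then have "h (degree (g ?n)) \<noteq> 0" using ch[of ?n] by (metis coeff_0 leading_coeff_0_iff order_refl)
    then have "poly (h (degree (g ?n))) t \<noteq> 0" using assms(2) h by (auto simp: algebraic_over_def)
    then show ?thesis using cH[of "degree (g ?n)"] N[of ?n] by auto
  qed
  moreover have "poly H x = 0"
  proof -
    have "poly H x = (\<Sum>j\<le>N. \<Sum>i\<le>?n. coeff (g i) j * x ^ j * t ^ i)"
      by (simp add: H_def h_def poly_sum poly_monom sum_distrib_left sum_distrib_right mult_ac)
    also have "\<dots> = (\<Sum>i\<le>?n. (\<Sum>j\<le>N. coeff (g i) j * x ^ j) * t ^ i)"
      by (subst sum.swap) (simp add: sum_distrib_right)
    also have "\<dots> = (\<Sum>i\<le>?n. d * coeff f i * t ^ i)" using gx g(2) by simp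
    also have "\<dots> = d * poly f t" by (simp add: poly_altdef sum_distrib_left mult.assoc)
    finally show ?thesis using f by simp
  qed
  ultimately show ?thesis unfolding algebraic_over_def by blast
qed

text \<open>As \<open>x\<close> is algebraic over L(t), the field L(x) consists of polynomials in
  \<open>x\<close> over L(t). Reduction modulo \<open>m\<close> bounds their degrees, so the
  products \<open>x ^ j * b\<close> generate.\<close>

lemma finite_over_exchange:
  assumes "finite_over (adjoin L x)" "\<not> algebraic_over L t"
  shows "finite_over (adjoin L t)"
proof -
  interpret Lx: subfield "adjoin L x" using is_subfield_adjoin by unfold_locales
  interpret Lt: subfield "adjoin L t" using is_subfield_adjoin by unfold_locales
  have alg: "algebraic_over (adjoin L t) x"
    using assms Lx.finite_over_imp_algebraic algebraic_over_exchange by blast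
  obtain B where B: "finite B" "\<forall>y. \<exists>c. range c \<subseteq> adjoin L x \<and> y = (\<Sum>b\<in>B. c b * b)"
    using assms by (auto simp: finite_over_def)
  obtain m where m: "poly_over (adjoin L t) m" "m \<noteq> 0" "poly m x = 0"
    using alg by (auto simp: algebraic_over_def)
  let ?E = "{poly g x | g. poly_over (adjoin L t) g}"
  have "c \<in> ?E" if "c \<in> L" for c
    using that subset_adjoin[of t] Lt.poly_over_pCons[of c 0]
    by (intro CollectI exI[of _ "[:c:]"]) auto
  moreover have "x \<in> ?E"
    by (intro CollectI exI[of _ "[:0, 1:]"]) simp
  ultimately have sub: "adjoin L x \<subseteq> ?E"
    using Lt.algebraic_ring_is_field[OF alg] by (intro adjoin_minimal) auto
  have red: "\<exists>e. range e \<subseteq> adjoin L t \<and> y = (\<Sum>j\<le>degree m. e j * x ^ j)" if y: "y \<in> adjoin L x" for y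
  proof -
    obtain g where g: "poly_over (adjoin L t) g" "y = poly g x" using y sub by blast
    obtain k r where r: "poly_over (adjoin L t) r" "g = k * m + r" "r = 0 \<or> degree r < degree m"
      using Lt.poly_over_division[OF m(1,2) g(1)] by blast
    have "y = poly r x" using g r m by simp
    also have "\<dots> = (\<Sum>j\<le>degree m. coeff r j * x ^ j)"
      unfolding poly_altdef using r(3) by (intro sum.mono_neutral_left) (auto simp: coeff_eq_0 split: if_splits)
    finally show ?thesis using r(1) by (intro exI[of _ "coeff r"]) (simp add: poly_over_def)
  qed
  show ?thesis
  proof (rule Lt.finite_overI[of "B \<times> {..degree m}" "\<lambda>(b, j). x ^ j * b"])
    fix y
    obtain c where c: "range c \<subseteq> adjoin L x" "y = (\<Sum>b\<in>B. c b * b)" using B by blast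
    have "\<forall>b. \<exists>e. range e \<subseteq> adjoin L t \<and> c b = (\<Sum>j\<le>degree m. e j * x ^ j)"
      using red c(1) by blast
    then obtain e where e: "\<And>b. range (e b) \<subseteq> adjoin L t" "\<And>b. c b = (\<Sum>j\<le>degree m. e b j * x ^ j)"
      by metis
    have "y = (\<Sum>b\<in>B. \<Sum>j\<le>degree m. e b j * (x ^ j * b))"
      unfolding c(2) by (simp add: e(2) sum_distrib_right mult.assoc)
    also have "\<dots> = (\<Sum>i\<in>B \<times> {..degree m}. case_prod e i * (case i of (b, j) \<Rightarrow> x ^ j * b))"
      by (simp add: sum.cartesian_product case_prod_unfold)
    finally show "\<exists>c. range c \<subseteq> adjoin L t \<and>
        y = (\<Sum>i\<in>B \<times> {..degree m}. c i * (case i of (b, j) \<Rightarrow> x ^ j * b))"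
      using e(1) by (intro exI[of _ "case_prod e"]) auto
  qed (use B in auto)
qed

end

text \<open>Each factor \<open>q\<close> of the power divides the cofactor of \<open>k\<close> and
  can be cancelled. This is applied to a power of a linear polynomial.\<close>

lemma dvd_prime_elem_power_imp_unit:
  fixes q :: "'a::idom"
  assumes q: "prime_elem q" and "\<not> q dvd k" and "k dvd q ^ n"
  shows "k dvd 1"
  using assms(3)
proof (induction n)
  case (Suc n)
  then obtain e where e: "q ^ Suc n = k * e" by blast
  then have "q dvd k * e" by (metis dvd_triv_left power_Suc)
  then have "q dvd e" using assms by (simp add: prime_elem_dvd_mult_iff)
  then obtain e' where "e = q * e'" by blast
  then have "q * q ^ n = q * (k * e')" using e by (simp add: mult_ac)
  then have "q ^ n = k * e'" using q by simp
  then show ?case using Suc.IH by simp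
qed simp

section \<open>Valuations and p-th powers\<close>

text \<open>The Frobenius map is additive on \<open>(x - y) + y\<close>; this avoids discussing the
  sign of a power of -1.\<close>

lemma diff_power_CHAR:
  assumes "prime CHAR('a)"
  shows "(x - y :: 'a::comm_ring_1) ^ CHAR('a) = x ^ CHAR('a) - y ^ CHAR('a)"
  using freshmans_dream[OF assms refl, of "x - y" y] by simp

text \<open>Elements of the prime field are their own Frobenius images. Hence integer factors pass
  through \<open>coord\<close> and \<open>C\<close>, which are only semilinear.\<close>

lemma of_nat_power_CHAR:
  assumes "prime CHAR('a)"
  shows "(of_nat n :: 'a::comm_ring_1) ^ CHAR('a) = of_nat n"
  using assms by (induction n) (simp_all add: freshmans_dream[OF assms refl] prime_gt_0_nat power_0_left)

locale place = K: subfield K for K :: "'f::field set" +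
  fixes P :: "'f place"
  assumes P: "P \<in> places K"
begin

text \<open>An integer version of the valuation, for arithmetic with orders. At 0 it has the default
  value 0, so its uses are guarded by nonzero arguments.\<close>

definition val :: "'f \<Rightarrow> int" where
  "val x = (case P x of Fin n \<Rightarrow> n | _ \<Rightarrow> 0)"

lemma P_0 [simp]: "P 0 = \<infinity>"
  using P by (simp add: places_def)

lemma P_eq_val: "x \<noteq> 0 \<Longrightarrow> P x = Fin (val x)"
  using P by (auto simp: places_def val_def)

lemma P_eq_infinity_iff [simp]: "P x = \<infinity> \<longleftrightarrow> x = 0"
  using P_eq_val[of x] by (cases "x = 0") simp_all

lemma P_mult: "P (x * y) = P x + P y"
  using P by (simp add: places_def)

lemma P_add_ge: "min (P x) (P y) \<le> P (x + y)"
  using P by (simp add: places_def)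

lemma P_const: "c \<in> K \<Longrightarrow> c \<noteq> 0 \<Longrightarrow> P c = Fin 0"
  using P by (simp add: places_def)

lemma P_power: "P x = Fin n \<Longrightarrow> P (x ^ k) = Fin (int k * n)"
  by (induction k) (simp_all add: P_const P_mult algebra_simps)

lemma P_uminus [simp]: "P (- x) = P x"
proof (cases "x = 0")
  case False
  have "P (- 1) = Fin 0" by (intro P_const) auto
  then show ?thesis using P_mult[of "- 1" x] False by (simp add: P_eq_val)
qed simp

text \<open>The converse bound comes from \<open>x = (x + y) + (- y)\<close>, since \<open>y\<close>
  has larger order than \<open>x\<close>.\<close>

lemma P_add_eq: "P x < P y \<Longrightarrow> P (x + y) = P x"
  using P_add_ge[of x y] P_add_ge[of "x + y" "- y"] by (auto simp: min_def split: if_splits)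

lemma P_sum_ge: "(\<And>i. i \<in> I \<Longrightarrow> n \<le> P (u i)) \<Longrightarrow> n \<le> P (sum u I)"
proof (induction I rule: infinite_finite_induct)
  case (insert i I)
  then have "n \<le> min (P (u i)) (P (sum u I))" by simp
  also have "\<dots> \<le> P (u i + sum u I)" by (rule P_add_ge)
  finally show ?case by (simp only: sum.insert[OF insert.hyps])
qed simp_all

text \<open>Nonzero terms of distinct orders cannot cancel. The guard \<open>u i \<noteq> 0\<close>
  allows several zero terms, which share the value \<infinity>.\<close>

lemma P_sum_distinct:
  assumes "finite I" "I \<noteq> {}" "\<And>i j. i \<in> I \<Longrightarrow> j \<in> I \<Longrightarrow> i \<noteq> j \<Longrightarrow> u i \<noteq> 0 \<Longrightarrow> P (u i) \<noteq> P (u j)"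
  shows "\<exists>j\<in>I. P (sum u I) = P (u j) \<and> (\<forall>i\<in>I. P (u j) \<le> P (u i))"
  using assms
proof (induction I rule: finite_ne_induct)
  case (insert a I)
  have "\<exists>j\<in>I. P (sum u I) = P (u j) \<and> (\<forall>i\<in>I. P (u j) \<le> P (u i))"
    by (rule insert.IH) (rule insert.prems; simp)
  then obtain j where j: "j \<in> I" "P (sum u I) = P (u j)" "\<forall>i\<in>I. P (u j) \<le> P (u i)" by blast
  show ?case
  proof (cases "u a = 0")
    case True
    then show ?thesis using j insert.hyps by auto
  next
    case False
    then have "P (u a) \<noteq> P (u j)" using insert.prems[of a j] insert.hyps j by auto
    then consider "P (u a) < P (u j)" | "P (u j) < P (u a)"
      unfolding neq_iff by blast
    then show ?thesis
    proof cases
      case 1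
      then have "P (u a + sum u I) = P (u a)" by (intro P_add_eq) (simp add: j(2))
      moreover have "P (u a) \<le> P (u i)" if "i \<in> I" for i
        using 1 j(3) that by (meson less_imp_le order_trans)
      ultimately show ?thesis using insert.hyps by (intro bexI[of _ a]) auto
    next
      case 2
      then have "P (sum u I + u a) = P (u j)" using P_add_eq[of "sum u I" "u a"] by (simp add: j(2))
      then show ?thesis using 2 insert.hyps j by (intro bexI[of _ j]) (auto simp: add.commute)
    qed
  qed
qed simp

end

section \<open>Expansions in powers of t with p-th powers as coefficients\<close>

locale uniformizer = place K P for K :: "'f::field set" and P +
  fixes t :: 'f and p :: nat
  assumes t: "P t = Fin 1" and prime_p: "prime p" and CHAR: "CHAR('f) = p"
begin

lemma prime_CHAR: "prime CHAR('f)"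
  by (simp add: CHAR prime_p)

lemma p_gt_1: "1 < p"
  by (rule prime_gt_1_nat[OF prime_p])

lemma p_gt_0 [simp]: "0 < p" and p_neq_0 [simp]: "p \<noteq> 0" and zero_power_p [simp]: "(0 :: 'f) ^ p = 0"
  using p_gt_1 by (simp_all add: power_0_left)

lemma power_p_add: "(x + y) ^ p = x ^ p + y ^ p" for x y :: 'f
  by (rule freshmans_dream[OF prime_CHAR CHAR[symmetric]])

lemma power_p_diff: "(x - y) ^ p = x ^ p - y ^ p" for x y :: 'f
  using diff_power_CHAR[OF prime_CHAR] by (simp add: CHAR)

lemma power_p_sum: "sum f A ^ p = (\<Sum>i\<in>A. f i ^ p)" for f :: "'b \<Rightarrow> 'f"
  by (rule freshmans_dream_sum[OF prime_CHAR CHAR[symmetric]])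

lemma of_nat_power_p: "(of_nat n :: 'f) ^ p = of_nat n"
  using of_nat_power_CHAR[OF prime_CHAR] by (simp add: CHAR)

lemma t_neq_0 [simp]: "t \<noteq> 0"
  using t by auto

lemma P_term: "a \<noteq> 0 \<Longrightarrow> P (a ^ p * t ^ i) = Fin (int p * val a + int i)"
  using P_power[of a "val a" p] P_power[OF t, of i] by (simp add: P_mult P_eq_val)

text \<open>The order of a nonzero \<open>a ^ p * t ^ i\<close> is congruent to \<open>i\<close>
  modulo \<open>p\<close>.\<close>

lemma P_term_distinct:
  assumes "i < p" "j < p" "i \<noteq> j" "a \<noteq> 0"
  shows "P (a ^ p * t ^ i) \<noteq> P (b ^ p * t ^ j)"
proof (cases "b = 0")
  case False
  have "int p * val a + int i \<noteq> int p * val b + int j"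
  proof
    assume "int p * val a + int i = int p * val b + int j"
    then have "(int p * val a + int i) mod int p = (int p * val b + int j) mod int p" by simp
    then show False using assms by simp
  qed
  then show ?thesis using assms False by (simp add: P_term)
qed (use assms in \<open>simp add: P_eq_val\<close>)

lemma P_expansion:
  "\<exists>j<p. P (\<Sum>i<p. a i ^ p * t ^ i) = P (a j ^ p * t ^ j) \<and>
     (\<forall>i<p. P (a j ^ p * t ^ j) \<le> P (a i ^ p * t ^ i))"
proof -
  have "\<exists>j\<in>{..<p}. P (\<Sum>i<p. a i ^ p * t ^ i) = P (a j ^ p * t ^ j) \<and>
     (\<forall>i\<in>{..<p}. P (a j ^ p * t ^ j) \<le> P (a i ^ p * t ^ i))"
  proof (rule P_sum_distinct)
    show "{..<p} \<noteq> {}" using p_gt_0 by (auto simp del: p_gt_0)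
    fix i j assume "i \<in> {..<p}" "j \<in> {..<p}" "i \<noteq> j" "a i ^ p * t ^ i \<noteq> 0"
    then show "P (a i ^ p * t ^ i) \<noteq> P (a j ^ p * t ^ j)" by (intro P_term_distinct) auto
  qed simp
  then show ?thesis by auto
qed

text \<open>Without cancellation no term can have finite order: the powers of \<open>t\<close> below
  \<open>p\<close> are independent over the \<open>p\<close>-th powers.\<close>

lemma expansion_eq_0:
  assumes "(\<Sum>i<p. a i ^ p * t ^ i) = 0" "i < p"
  shows "a i = 0"
proof -
  obtain j where "P (a j ^ p * t ^ j) = \<infinity>" "P (a j ^ p * t ^ j) \<le> P (a i ^ p * t ^ i)"
    using P_expansion[of a] assms by auto
  then show ?thesis by simp
qed

lemma expansion_eqD:
  assumes "(\<Sum>i<p. a i ^ p * t ^ i) = (\<Sum>i<p. b i ^ p * t ^ i)" "i < p"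
  shows "a i = b i"
proof -
  have "(\<Sum>i<p. (a i - b i) ^ p * t ^ i) = 0"
    using assms(1) by (simp add: power_p_diff left_diff_distrib sum_subtractf)
  from expansion_eq_0[OF this assms(2)] show ?thesis by simp
qed

text \<open>The sum has the order of its minimal term, and the residue of this order modulo
  \<open>p\<close> is the index of that term.\<close>

lemma expansion_val:
  assumes "P (\<Sum>i<p. a i ^ p * t ^ i) = Fin (int p * r + int k)" "k < p"
  shows "P (a k) = Fin r" "\<And>i. i < p \<Longrightarrow> Fin (int p * r + int k) \<le> P (a i ^ p * t ^ i)"
proof -
  obtain j where j: "j < p" "P (a j ^ p * t ^ j) = Fin (int p * r + int k)"
    and min: "\<forall>i<p. P (a j ^ p * t ^ j) \<le> P (a i ^ p * t ^ i)"
    using P_expansion[of a] assms by auto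
  have "a j \<noteq> 0" using j by (intro notI) simp
  then have eq: "int p * val (a j) + int j = int p * r + int k" using j by (simp add: P_term)
  then have "(int p * val (a j) + int j) mod int p = (int p * r + int k) mod int p" by simp
  then have "j = k" using assms j by simp
  then show "P (a k) = Fin r" using eq \<open>a j \<noteq> 0\<close> by (simp add: P_eq_val)
  show "Fin (int p * r + int k) \<le> P (a i ^ p * t ^ i)" if "i < p" for i
    using min j that by simp
qed

lemma is_subfield_powers:
  fixes L :: "'f set"
  assumes "is_subfield L"
  shows "is_subfield ((\<lambda>a. a ^ p) ` L)"
proof -
  interpret L: subfield L by unfold_locales fact
  let ?E = "(\<lambda>a. a ^ p) ` L"
  have "0 ^ p \<in> ?E" "1 ^ p \<in> ?E" using L.zero L.one by blast+
  moreover have "a ^ p + b ^ p \<in> ?E" if "a \<in> L" "b \<in> L" for a b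
    using that by (intro image_eqI[of _ _ "a + b"]) (auto simp: power_p_add)
  moreover have "- (a ^ p) \<in> ?E" if "a \<in> L" for a
    using that power_p_diff[of 0 a] by (intro image_eqI[of _ _ "- a"]) auto
  moreover have "a ^ p * b ^ p \<in> ?E" if "a \<in> L" "b \<in> L" for a b
    using that by (intro image_eqI[of _ _ "a * b"]) (auto simp: power_mult_distrib)
  moreover have "inverse (a ^ p) \<in> ?E" if "a \<in> L" for a
    using that by (intro image_eqI[of _ _ "inverse a"]) (auto simp: power_inverse)
  ultimately show ?thesis unfolding is_subfield_def by (simp add: ball_simps)
qed

text \<open>Both claims follow since \<open>t\<close> is a root of \<open>X\<^sup>p - t\<^sup>p\<close>, which has coefficients in \<open>L\<^sup>p\<close>.\<close>

lemma ring_over_powers: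
  assumes "is_subfield L" "t \<in> L"
  shows "is_subfield {poly g t | g. poly_over ((\<lambda>a. a ^ p) ` L) g}" (is "is_subfield ?E")
    and "poly_over ((\<lambda>a. a ^ p) ` L) g \<Longrightarrow> \<exists>a. range a \<subseteq> L \<and> poly g t = (\<Sum>i<p. a i ^ p * t ^ i)"
proof -
  let ?L = "(\<lambda>a. a ^ p) ` L"
  interpret L: subfield L by unfold_locales fact
  interpret Lp: subfield ?L using is_subfield_powers[OF assms(1)] by unfold_locales
  define m where "m = monom 1 p - [:t ^ p:]"
  have "poly_over ?L (monom 1 p - [:t ^ p:])"
    using assms(2) by (intro Lp.poly_over_diff Lp.poly_over_monom Lp.poly_over_pCons) auto
  then have m: "poly_over ?L m" by (simp add: m_def)
  have "coeff m p = 1" using p_gt_0 by (simp add: m_def coeff_pCons split: nat.split)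
  then have nz: "m \<noteq> 0" by auto
  have "degree m \<le> p" unfolding m_def by (intro degree_diff_le) (auto simp: degree_monom_le)
  have mt: "poly m t = 0" by (simp add: m_def poly_monom)
  have "algebraic_over ?L t" unfolding algebraic_over_def using m nz mt by blast
  then show "is_subfield ?E" by (rule Lp.algebraic_ring_is_field)
  assume g: "poly_over ?L g"
  obtain k r where r: "poly_over ?L r" "g = k * m + r" "r = 0 \<or> degree r < degree m"
    using Lp.poly_over_division[OF m nz g] by blast
  then have "r = 0 \<or> degree r < p" using \<open>degree m \<le> p\<close> by auto
  have "\<forall>i. \<exists>a\<in>L. coeff r i = a ^ p" using Lp.coeff[OF r(1)] by blast
  then obtain a where a: "\<And>i. a i \<in> L" "\<And>i. coeff r i = a i ^ p" by metis
  have "poly g t = poly r t" using r(2) mt by simp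
  also have "\<dots> = (\<Sum>i<p. coeff r i * t ^ i)"
    unfolding poly_altdef using \<open>r = 0 \<or> degree r < p\<close>
    by (intro sum.mono_neutral_left) (auto simp: coeff_eq_0 Suc_le_eq)
  finally show "\<exists>a. range a \<subseteq> L \<and> poly g t = (\<Sum>i<p. a i ^ p * t ^ i)"
    using a by (intro exI[of _ a]) auto
qed

end

section \<open>Local parameters are separating\<close>

locale local_parameter = uniformizer K P t p for K :: "'f::field set" and P t p +
  assumes function_field: "function_field K" and perfect: "c \<in> K \<Longrightarrow> \<exists>d\<in>K. c = d ^ p"
begin

text \<open>\<open>K\<close> contains everything algebraic over it, and a constant never has order
  1.\<close>

lemma transcendental_t: "\<not> algebraic_over K t"
proof
  assume "algebraic_over K t"
  then have "t \<in> K" using function_field by (simp add: function_field_def)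
  then show False using t P_const[of t] by simp
qed

lemma finite_over_adjoin_t: "finite_over (adjoin K t)"
  using function_field K.finite_over_exchange transcendental_t by (auto simp: function_field_def)

text \<open>Polynomials in \<open>t\<close> over the \<open>p\<close>-th powers of K(t) form a field
  containing \<open>K\<close>, by \<open>perfect\<close>, and \<open>t\<close>, hence all of K(t).
  The descent below needs the coefficients to lie in K(t) again.\<close>

lemma expansion_adjoin_t:
  assumes "c \<in> adjoin K t"
  shows "\<exists>a. range a \<subseteq> adjoin K t \<and> c = (\<Sum>i<p. a i ^ p * t ^ i)"
proof -
  interpret L: subfield "adjoin K t" using K.is_subfield_adjoin by unfold_locales
  let ?L = "(\<lambda>a. a ^ p) ` adjoin K t"
  let ?E = "{poly g t | g. poly_over ?L g}"
  interpret Lp: subfield ?L using is_subfield_powers[OF L.is_subfield] by unfold_locales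
  note E = ring_over_powers[OF L.is_subfield K.generator_in_adjoin]
  have "c \<in> ?E" if "c \<in> K" for c
  proof -
    obtain d where "d \<in> K" "c = d ^ p" using perfect \<open>c \<in> K\<close> by blast
    then have "poly_over ?L [:c:]" using K.subset_adjoin by (intro Lp.poly_over_pCons) auto
    then show ?thesis by (intro CollectI exI[of _ "[:c:]"]) auto
  qed
  moreover have "t \<in> ?E" by (intro CollectI exI[of _ "[:0, 1:]"]) simp
  ultimately have "adjoin K t \<subseteq> ?E" using E(1) by (intro K.adjoin_minimal) auto
  then show ?thesis using assms E(2) by blast
qed

text \<open>
  If the minimal polynomial of \<open>y\<close> over \<open>K(t)\<close> were a polynomial in \<open>Y\<^sup>p\<close>, expanding its coefficients
  as \<open>\<Sum> a\<^sub>i\<^sup>p t\<^sup>i\<close> would give equations for \<open>y\<close> of degree smaller by the factor \<open>p\<close>.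
\<close>

lemma separable_over_adjoin_t: "separable_over (adjoin K t) y"
proof -
  interpret L: subfield "adjoin K t" using K.is_subfield_adjoin by unfold_locales
  have "algebraic_over (adjoin K t) y"
    using finite_over_adjoin_t by (rule L.finite_over_imp_algebraic)
  then obtain g where g: "poly_over (adjoin K t) g" "g \<noteq> 0" "poly g y = 0"
    and min: "\<And>h. poly_over (adjoin K t) h \<Longrightarrow> h \<noteq> 0 \<Longrightarrow> poly h y = 0 \<Longrightarrow> degree g \<le> degree h"
    using L.minimal_poly by blast
  have deg: "0 < degree g"
  proof (rule gr0I)
    assume "degree g = 0"
    then obtain c where "g = [:c:]" by (rule degree_eq_zeroE)
    then show False using g by simp
  qed
  have nz: "pderiv g \<noteq> 0"
  proof
    assume "pderiv g = 0"
    \<comment> \<open>In characteristic \<open>p\<close>, differentiation kills only the terms whose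
      exponent is divisible by \<open>p\<close>.\<close>
    have dvd: "p dvd i" if "coeff g i \<noteq> 0" for i
    proof (cases i)
      case (Suc n)
      have "of_nat (Suc n) * coeff g (Suc n) = 0"
        using \<open>pderiv g = 0\<close> by (metis coeff_0 coeff_pderiv)
      then have "of_nat i = (0 :: 'f)" using that Suc by simp
      then show ?thesis by (simp add: of_nat_eq_0_iff_char_dvd CHAR)
    qed simp
    have "p dvd degree g" using dvd[of "degree g"] g by simp
    then obtain e where e: "degree g = p * e" by blast
    have "0 < e" using deg e by (cases e) auto
    then have lt: "e < degree g" using e p_gt_1 by simp
    have "\<forall>j. \<exists>a. range a \<subseteq> adjoin K t \<and> coeff g (p * j) = (\<Sum>i<p. a i ^ p * t ^ i)"
      using expansion_adjoin_t L.coeff[OF g(1)] by blast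
    then obtain a where a: "\<And>j. range (a j) \<subseteq> adjoin K t"
      "\<And>j. coeff g (p * j) = (\<Sum>i<p. a j i ^ p * t ^ i)" by metis
    \<comment> \<open>Chosen so that \<open>poly g y\<close> is the sum of the terms
      \<open>poly (h i) y ^ p * t ^ i\<close>.\<close>
    define h where "h i = (\<Sum>j\<le>e. monom (a j i) j)" for i
    have h: "poly_over (adjoin K t) (h i)" for i
      unfolding h_def using a(1) by (intro L.poly_over_sum L.poly_over_monom) blast
    have "degree (h i) \<le> e" for i
      unfolding h_def by (intro degree_sum_le) (auto intro: order.trans[OF degree_monom_le])
    have hy: "poly (h i) y = (\<Sum>j\<le>e. a j i * y ^ j)" for i
      by (simp add: h_def poly_sum poly_monom)
    have "0 = (\<Sum>i\<le>p * e. coeff g i * y ^ i)" using g(3) by (simp add: poly_altdef e)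
    also have "\<dots> = (\<Sum>i\<in>(*) p ` {..e}. coeff g i * y ^ i)"
    proof (rule sum.mono_neutral_right)
      show "\<forall>i\<in>{..p * e} - (*) p ` {..e}. coeff g i * y ^ i = 0"
      proof
        fix i assume i: "i \<in> {..p * e} - (*) p ` {..e}"
        have "\<not> p dvd i"
        proof
          assume "p dvd i"
          then obtain k where "i = p * k" by blast
          then show False using i by auto
        qed
        then show "coeff g i * y ^ i = 0" using dvd by auto
      qed
    qed auto
    also have "\<dots> = (\<Sum>j\<le>e. coeff g (p * j) * y ^ (p * j))"
      by (subst sum.reindex) (auto simp: inj_on_def)
    also have "\<dots> = (\<Sum>j\<le>e. \<Sum>i<p. (a j i * y ^ j) ^ p * t ^ i)"
      unfolding a(2) by (simp add: sum_distrib_left sum_distrib_right power_mult_distrib mult_ac flip: power_mult)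
    also have "\<dots> = (\<Sum>i<p. (\<Sum>j\<le>e. a j i * y ^ j) ^ p * t ^ i)"
      by (subst sum.swap) (simp add: power_p_sum sum_distrib_right)
    finally have "(\<Sum>i<p. poly (h i) y ^ p * t ^ i) = 0" by (simp add: hy)
    then have "poly (h i) y = 0" if "i < p" for i using expansion_eq_0[of "\<lambda>i. poly (h i) y"] that by blast
    \<comment> \<open>Minimality of \<open>g\<close> kills each \<open>h i\<close>, and with them
      the leading coefficient of \<open>g\<close>.\<close>
    then have "h i = 0" if "i < p" for i
      using min[OF h] \<open>degree (h i) \<le> e\<close> lt that by (metis leD le_less_trans)
    moreover have "coeff (h i) e = a e i" for i by (simp add: h_def coeff_sum)
    ultimately have "a e i = 0" if "i < p" for i using that by (metis coeff_0)
    then have "coeff g (p * e) = 0" using a(2)[of e] by simp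
    then show False using e g by (metis leading_coeff_0_iff)
  qed
  have "degree (pderiv g) \<le> degree g - 1"
    by (intro degree_le) (auto simp: coeff_pderiv coeff_eq_0)
  then have deg': "degree (pderiv g) < degree g" using deg by linarith
  \<comment> \<open>The gcd over K(t) has degree below that of \<open>g\<close>, so irreducibility
    makes it a unit. The Bezout relation then gives coprimality over the whole field.\<close>
  obtain h u w g1 g2 where h: "poly_over (adjoin K t) h" "poly_over (adjoin K t) g1"
    "h = u * g + w * pderiv g" "g = h * g1" "pderiv g = h * g2"
    using L.poly_over_bezout[OF g(1) L.poly_over_pderiv[OF g(1)]] by metis
  have "degree h \<le> degree (pderiv g)" using h(5) nz by (metis dvd_imp_degree_le dvd_triv_left)
  moreover have "degree g = degree h + degree g1"
  proof -
    have "h \<noteq> 0" "g1 \<noteq> 0" using g(2) unfolding h(4) by auto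
    then show ?thesis by (subst h(4)) (rule degree_mult_eq)
  qed
  moreover have "degree h = 0 \<or> degree g1 = 0"
    by (rule L.minimal_poly_mult[OF g min h(1,2,4)])
  ultimately have "degree h = 0" using deg' by auto
  moreover have "h \<noteq> 0" using g(2) unfolding h(4) by auto
  ultimately have unit: "is_unit h" by (simp add: is_unit_iff_degree)
  have "coprime g (pderiv g)"
  proof (rule coprimeI)
    fix c assume "c dvd g" "c dvd pderiv g"
    then have "c dvd h" unfolding h(3) by (intro dvd_add dvd_mult)
    then show "is_unit c" using unit by (rule dvd_trans)
  qed
  then show ?thesis unfolding separable_over_def using g by blast
qed

lemma separating_t: "separating K t"
  unfolding separating_def using finite_over_adjoin_t separable_over_adjoin_t by blast

text \<open>
  The field \<open>F\<close> is separable over the subfield \<open>F\<^sup>p(t)\<close>, and also purely inseparable: every \<open>y\<close> is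
  the only root of \<open>X\<^sup>p - y\<^sup>p = (X - y)\<^sup>p\<close>. Hence the two fields agree.
\<close>

lemma ex_expansion: "\<exists>a. y = (\<Sum>i<p. a i ^ p * t ^ i)"
proof -
  let ?L = "range (\<lambda>a :: 'f. a ^ p)"
  have UNIV: "is_subfield (UNIV :: 'f set)" by (simp add: is_subfield_def)
  interpret Fp: subfield ?L using is_subfield_powers[OF UNIV] by unfold_locales
  note E = ring_over_powers[OF UNIV UNIV_I]
  define M where "M = {poly g t | g. poly_over ?L g}"
  interpret M: subfield M using E(1) by unfold_locales (simp add: M_def)
  have pow: "a ^ p \<in> M" for a
    unfolding M_def by (intro CollectI exI[of _ "[:a ^ p:]"]) (auto intro: Fp.poly_over_pCons)
  have "K \<subseteq> M" using perfect pow by blast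
  moreover have "t \<in> M" unfolding M_def by (intro CollectI exI[of _ "[:0, 1:]"]) simp
  ultimately have "adjoin K t \<subseteq> M" using M.is_subfield by (intro K.adjoin_minimal)
  obtain g where g: "poly_over (adjoin K t) g" "coprime g (pderiv g)" "poly g y = 0"
    using separable_over_adjoin_t by (auto simp: separable_over_def)
  have gM: "poly_over M g" using g(1) \<open>adjoin K t \<subseteq> M\<close> by (auto simp: poly_over_def)
  let ?X = "[:- y, 1:]"
  have "[:y:] ^ p = [:y ^ p:]" by (simp add: poly_const_pow)
  moreover have "?X = monom 1 1 - [:y:]" by (simp add: monom_altdef)
  \<comment> \<open>The freshman's dream in the polynomial ring, which has the same
    characteristic.\<close>
  ultimately have Xp: "?X ^ p = monom 1 p - [:y ^ p:]"
    using diff_power_CHAR[where 'a = "'f poly", of "monom 1 1" "[:y:]"] prime_p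
    by (simp add: monom_power CHAR)
  have "poly_over M (?X ^ p)"
    unfolding Xp using pow by (intro M.poly_over_diff M.poly_over_monom M.poly_over_pCons) auto
  \<comment> \<open>The gcd \<open>h\<close> over \<open>M\<close> divides (X - y)^p and vanishes at
    \<open>y\<close>, only once because \<open>g\<close> is separable. So \<open>h\<close> is a
    constant times X - y, and \<open>y\<close> is a quotient of its coefficients.\<close>
  then obtain h u w g1 g2 where h: "poly_over M h" "h = u * g + w * ?X ^ p" "g = h * g1" "?X ^ p = h * g2"
    using M.poly_over_bezout[OF gM] by metis
  have "poly h y = 0" unfolding h(2) using g(3) by simp
  then obtain k where k: "h = ?X * k" by (auto simp: poly_eq_0_iff_dvd)
  have "\<not> ?X dvd k"
  proof
    assume "?X dvd k"
    then obtain k' where k': "k = ?X * k'" by blast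
    have g': "g = ?X * (?X * (k' * g1))" using h(3) by (simp only: k k' mult.assoc)
    have "pderiv g = ?X * pderiv (?X * (k' * g1)) + ?X * (k' * g1) * pderiv ?X"
      by (subst g') (rule pderiv_mult)
    then have "?X dvd pderiv g" by (metis dvd_add dvd_triv_left dvd_mult2)
    moreover have "?X dvd g" using g' by (metis dvd_triv_left)
    ultimately have "is_unit ?X" using g(2) by (metis coprime_common_divisor)
    then show False by (simp add: is_unit_iff_degree)
  qed
  moreover have "k dvd ?X ^ p" unfolding h(4) k by (intro dvd_mult2 dvd_triv_right)
  ultimately have "is_unit k"
    by (rule dvd_prime_elem_power_imp_unit[OF prime_elem_linear_field_poly[OF one_neq_zero]])
  then obtain c where c: "k = [:c:]" "c \<noteq> 0" by (metis is_unit_poly_iff not_is_unit_0 pCons_0_0)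
  then have "coeff h 1 = c" "coeff h 0 = - y * c" using k by auto
  then have "c \<in> M" "- y * c \<in> M" using M.coeff[OF h(1)] by metis+
  then have "- (- y * c / c) \<in> M" by blast
  then have "y \<in> M" using c by simp
  then show ?thesis using E(2) unfolding M_def by blast
qed

end

section \<open>The derivation d/dt and the Cartier operator\<close>

context local_parameter
begin

text \<open>Only the entries with \<open>i < p\<close> are determined by \<open>y\<close>, hence the
  bound on \<open>i\<close> in the lemmas below.\<close>

definition coord :: "'f \<Rightarrow> nat \<Rightarrow> 'f" where
  "coord y = (SOME a. y = (\<Sum>i<p. a i ^ p * t ^ i))"

lemma expansion: "y = (\<Sum>i<p. coord y i ^ p * t ^ i)"
  unfolding coord_def using ex_expansion by (rule someI_ex)

lemma coord_eqI: "y = (\<Sum>i<p. a i ^ p * t ^ i) \<Longrightarrow> i < p \<Longrightarrow> coord y i = a i"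
  using expansion_eqD[of "coord y" a i] expansion[of y] by simp

lemma coord_add: "i < p \<Longrightarrow> coord (x + y) i = coord x i + coord y i"
proof (rule coord_eqI)
  have "x + y = (\<Sum>i<p. coord x i ^ p * t ^ i) + (\<Sum>i<p. coord y i ^ p * t ^ i)"
    unfolding expansion[symmetric] ..
  then show "x + y = (\<Sum>i<p. (coord x i + coord y i) ^ p * t ^ i)"
    by (simp add: power_p_add distrib_right sum.distrib)
qed

lemma coord_power_p_mult: "i < p \<Longrightarrow> coord (a ^ p * y) i = a * coord y i"
proof (rule coord_eqI)
  have "a ^ p * y = a ^ p * (\<Sum>i<p. coord y i ^ p * t ^ i)"
    unfolding expansion[symmetric] ..
  then show "a ^ p * y = (\<Sum>i<p. (a * coord y i) ^ p * t ^ i)"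
    by (simp add: power_mult_distrib sum_distrib_left mult.assoc)
qed

lemma coord_t_power: "i < p \<Longrightarrow> coord (t ^ k) i = (if i = k mod p then t ^ (k div p) else 0)"
proof (rule coord_eqI)
  have "(\<Sum>i<p. (if i = k mod p then t ^ (k div p) else 0) ^ p * t ^ i) =
      (\<Sum>i<p. if i = k mod p then (t ^ (k div p)) ^ p * t ^ i else 0)"
    by (intro sum.cong) auto
  also have "\<dots> = (t ^ (k div p)) ^ p * t ^ (k mod p)" by (simp add: sum.delta)
  also have "\<dots> = t ^ k" by (simp flip: power_mult power_add)
  finally show "t ^ k = (\<Sum>i<p. (if i = k mod p then t ^ (k div p) else 0) ^ p * t ^ i)" by simp
qed

lemma coord_0 [simp]: "i < p \<Longrightarrow> coord 0 i = 0"
  by (rule coord_eqI) simp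

lemma coord_sum: "i < p \<Longrightarrow> coord (sum f A) i = (\<Sum>a\<in>A. coord (f a) i)"
  by (induction A rule: infinite_finite_induct) (simp_all add: coord_add)

lemma coord_of_nat_mult: "i < p \<Longrightarrow> coord (of_nat n * y) i = of_nat n * coord y i"
  using coord_power_p_mult[of i "of_nat n" y] by (simp add: of_nat_power_p)

text \<open>Termwise differentiation with the \<open>p\<close>-th powers as constants. At
  \<open>i = 0\<close> the exponent is truncated, but the factor is 0.\<close>

definition D :: "'f \<Rightarrow> 'f" where
  "D y = (\<Sum>i<p. of_nat i * (coord y i ^ p * t ^ (i - 1)))"

lemma D_add: "D (x + y) = D x + D y"
  by (simp add: D_def coord_add power_p_add algebra_simps sum.distrib)

lemma D_power_p_mult: "D (a ^ p * y) = a ^ p * D y"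
  by (simp add: D_def coord_power_p_mult power_mult_distrib sum_distrib_left)
    (simp add: mult_ac)

text \<open>For \<open>k \<ge> p\<close> the multiple of \<open>p\<close> in the exponent goes into
  a \<open>p\<close>-th power, and \<open>k\<close> and \<open>k mod p\<close> agree in the
  field.\<close>

lemma D_t_power: "D (t ^ k) = of_nat k * t ^ (k - 1)"
proof -
  let ?r = "k mod p"
  have "D (t ^ k) = (\<Sum>i<p. if i = ?r then of_nat i * ((t ^ (k div p)) ^ p * t ^ (i - 1)) else 0)"
    unfolding D_def by (intro sum.cong) (auto simp: coord_t_power)
  also have "\<dots> = of_nat ?r * ((t ^ (k div p)) ^ p * t ^ (?r - 1))" by (simp add: sum.delta)
  also have "of_nat ?r = (of_nat k :: 'f)"
  proof -
    have "(of_nat k :: 'f) = of_nat (p * (k div p) + ?r)" by simp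
    also have "\<dots> = of_nat ?r" using of_nat_CHAR[where 'a = 'f] by (simp only: CHAR of_nat_add of_nat_mult mult_zero_left add_0)
    finally show ?thesis by simp
  qed
  also have "of_nat k * ((t ^ (k div p)) ^ p * t ^ (?r - 1)) = of_nat k * t ^ (k - 1)"
  proof (cases "?r = 0")
    case True
    then have "of_nat k = (0 :: 'f)" by (simp add: of_nat_eq_0_iff_char_dvd CHAR mod_eq_0_iff_dvd)
    then show ?thesis by simp
  next
    case False
    have "k - 1 = k div p * p + (?r - 1)" using False div_mult_mod_eq[of k p] by linarith
    then show ?thesis by (simp add: power_add power_mult)
  qed
  finally show ?thesis .
qed

lemma D_0 [simp]: "D 0 = 0" and D_1 [simp]: "D 1 = 0" and D_t [simp]: "D t = 1"
  using D_power_p_mult[of 0 0] D_t_power[of 0] D_t_power[of 1] by simp_all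

lemma D_power_p [simp]: "D (a ^ p) = 0"
  using D_power_p_mult[of a 1] by simp

lemma D_sum: "D (sum f A) = (\<Sum>a\<in>A. D (f a))"
  by (induction A rule: infinite_finite_induct) (simp_all add: D_add)

lemma D_const: "c \<in> K \<Longrightarrow> D c = 0"
  using perfect D_power_p by blast

text \<open>Both sides are bilinear over the \<open>p\<close>-th powers, so powers of
  \<open>t\<close> suffice.\<close>

lemma D_mult: "D (x * y) = x * D y + y * D x"
proof -
  have eq: "D (t ^ i * t ^ j) = t ^ i * D (t ^ j) + t ^ j * D (t ^ i)" for i j
    unfolding power_add[symmetric] D_t_power
    by (cases i; cases j) (simp_all add: algebra_simps power_add)
  let ?a = "\<lambda>i. coord x i ^ p" and ?b = "\<lambda>j. coord y j ^ p"
  have x: "x = (\<Sum>i<p. ?a i * t ^ i)" and y: "y = (\<Sum>j<p. ?b j * t ^ j)" by (rule expansion)+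
  have Dx: "D x = (\<Sum>i<p. ?a i * D (t ^ i))" and Dy: "D y = (\<Sum>j<p. ?b j * D (t ^ j))"
    by (subst x y, simp only: D_sum D_power_p_mult)+
  have "x * y = (\<Sum>i<p. \<Sum>j<p. (coord x i * coord y j) ^ p * (t ^ i * t ^ j))"
    by (subst x, subst y) (simp add: sum_product power_mult_distrib mult_ac)
  then have "D (x * y) = (\<Sum>i<p. \<Sum>j<p. (?a i * ?b j) * (t ^ i * D (t ^ j) + t ^ j * D (t ^ i)))"
    by (simp only: D_sum D_power_p_mult eq) (simp only: power_mult_distrib)
  also have "\<dots> = (\<Sum>i<p. ?a i * t ^ i) * (\<Sum>j<p. ?b j * D (t ^ j)) +
      (\<Sum>j<p. ?b j * t ^ j) * (\<Sum>i<p. ?a i * D (t ^ i))"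
  proof -
    have comm: "(\<Sum>j<p. ?b j * t ^ j) * (\<Sum>i<p. ?a i * D (t ^ i)) =
        (\<Sum>i<p. ?a i * D (t ^ i)) * (\<Sum>j<p. ?b j * t ^ j)" by (rule mult.commute)
    show ?thesis
      by (subst comm, unfold sum_product) (simp add: distrib_left sum.distrib mult_ac)
  qed
  also have "\<dots> = x * D y + y * D x"
    using x y Dx Dy by simp
  finally show ?thesis .
qed

lemma D_power: "D (x ^ n) = of_nat n * x ^ (n - 1) * D x"
proof (induction n)
  case (Suc n)
  then show ?case by (cases n) (simp_all add: D_mult algebra_simps)
qed simp

section \<open>The Cartier operator on coefficients of dt\<close>

definition C :: "'f \<Rightarrow> 'f" where
  "C y = coord y (p - 1)"

lemma p_minus_1_less: "p - 1 < p"
  using p_gt_0 by (simp del: p_gt_0)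

lemma C_add: "C (x + y) = C x + C y"
  unfolding C_def by (rule coord_add[OF p_minus_1_less])

lemma C_sum: "C (sum f A) = (\<Sum>a\<in>A. C (f a))"
  unfolding C_def by (rule coord_sum[OF p_minus_1_less])

lemma C_power_p_mult: "C (a ^ p * y) = a * C y"
  unfolding C_def by (rule coord_power_p_mult[OF p_minus_1_less])

lemma C_of_nat_mult: "C (of_nat n * y) = of_nat n * C y"
  unfolding C_def by (rule coord_of_nat_mult[OF p_minus_1_less])

text \<open>Exact forms are killed: differentiating an exponent \<open>i < p\<close> never yields
  \<open>p - 1\<close>.\<close>

lemma C_D [simp]: "C (D y) = 0"
proof -
  have "C (of_nat i * (coord y i ^ p * t ^ (i - 1))) = 0" if "i < p" for i
  proof (cases i)
    case 0
    then show ?thesis using C_of_nat_mult[of 0 0] by simp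
  next
    case (Suc k)
    then have "coord (t ^ k) (p - 1) = 0"
      using that by (subst coord_t_power[OF p_minus_1_less]) auto
    then have "C (t ^ k) = 0" by (simp add: C_def)
    then show ?thesis using Suc by (simp only: C_of_nat_mult C_power_p_mult diff_Suc_1 mult_zero_right)
  qed
  then show ?thesis unfolding D_def C_sum by (intro sum.neutral) auto
qed

text \<open>Up to the factor \<open>i + 1\<close>, invertible modulo \<open>p\<close>, this is the
  derivative of \<open>x ^ Suc i\<close>.\<close>

lemma C_power_mult_D_eq_0:
  assumes "i < p - 1"
  shows "C (x ^ i * D x) = 0"
proof -
  have "of_nat (Suc i) * C (x ^ i * D x) = C (D (x ^ Suc i))"
    by (simp only: D_power C_of_nat_mult diff_Suc_1 mult.assoc)
  then have "of_nat (Suc i) * C (x ^ i * D x) = 0" by simp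
  moreover have "\<not> p dvd Suc i" using assms by (auto dest: dvd_imp_le)
  then have "of_nat (Suc i) \<noteq> (0 :: 'f)" by (simp only: of_nat_eq_0_iff_char_dvd CHAR not_False_eq_True)
  ultimately show ?thesis by (metis mult_eq_0_iff)
qed

text \<open>
  The set of all \<open>x\<close> with \<open>C (x\<^sup>p\<^sup>-\<^sup>1 dx) = dx\<close> contains \<open>t\<close> and all \<open>p\<close>-th powers. It is closed under
  products since \<open>dx/x\<close> is additive in products, and under \<open>x \<mapsto> x + 1\<close> by the previous lemma, hence
  under sums \<open>x + y = y (x y\<^sup>p\<^sup>-\<^sup>1 (1/y)\<^sup>p + 1)\<close>.
\<close>

lemma C_power_mult_D: "C (x ^ (p - 1) * D x) = D x"
proof -
  define S where "S = {x. C (x ^ (p - 1) * D x) = D x}"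
  have Suc_p: "Suc (p - 1) = p" using p_gt_0 by (simp del: p_gt_0)
  have pw: "x ^ (p - 1) * x = x ^ p" for x :: 'f
    using power_Suc2[of x "p - 1"] by (simp add: Suc_p)
  have mult: "x * y \<in> S" if "x \<in> S" "y \<in> S" for x y
  proof -
    have "(x * y) ^ (p - 1) * D (x * y) =
        x ^ p * (y ^ (p - 1) * D y) + y ^ p * (x ^ (p - 1) * D x)"
      by (simp add: D_mult power_mult_distrib algebra_simps flip: pw)
    then have "C ((x * y) ^ (p - 1) * D (x * y)) = x * C (y ^ (p - 1) * D y) + y * C (x ^ (p - 1) * D x)"
      by (simp only: C_add C_power_p_mult)
    then show ?thesis using that by (simp add: S_def D_mult)
  qed
  have pth: "a ^ p \<in> S" for a
    using C_of_nat_mult[of 0 0] by (simp add: S_def)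
  have 1: "1 \<in> S" using pth[of 1] by simp
  have 0: "0 \<in> S" using pth[of 0] by simp
  have tS: "t \<in> S"
    using coord_t_power[OF p_minus_1_less, of "p - 1"] by (simp add: S_def C_def)
  have power: "x ^ n \<in> S" if "x \<in> S" for x n
    by (induction n) (use 1 mult that in auto)
  have Suc: "x + 1 \<in> S" if "x \<in> S" for x
  proof -
    \<comment> \<open>Only the top binomial term, with coefficient 1, survives
      \<open>C\<close>.\<close>
    have "(x + 1) ^ (p - 1) * D (x + 1) = (\<Sum>i\<le>p - 1. of_nat ((p - 1) choose i) * (x ^ i * D x))"
      by (simp add: binomial_ring D_add sum_distrib_right mult.assoc)
    then have "C ((x + 1) ^ (p - 1) * D (x + 1)) = (\<Sum>i\<le>p - 1. of_nat ((p - 1) choose i) * C (x ^ i * D x))"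
      by (simp only: C_sum C_of_nat_mult)
    also have "\<dots> = (\<Sum>i\<in>{p - 1}. of_nat ((p - 1) choose i) * C (x ^ i * D x))"
      by (intro sum.mono_neutral_right) (auto simp: C_power_mult_D_eq_0)
    finally show ?thesis using that by (simp add: S_def D_add)
  qed
  have add: "x + y \<in> S" if "x \<in> S" "y \<in> S" for x y
  proof (cases "y = 0")
    case False
    have "x * y ^ (p - 1) * inverse y ^ p + 1 \<in> S"
      using that by (intro Suc mult power pth)
    moreover have "y * (x * y ^ (p - 1) * inverse y ^ p + 1) = x + y"
      using False by (simp add: field_simps flip: pw)
    ultimately show ?thesis using mult[OF \<open>y \<in> S\<close>] by metis
  qed (use that in simp)
  have sum: "sum f A \<in> S" if "\<And>i. i \<in> A \<Longrightarrow> f i \<in> S" for f :: "nat \<Rightarrow> 'f" and A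
    using that by (induction A rule: infinite_finite_induct) (auto intro: 0 add)
  have "x \<in> S"
    by (subst expansion) (intro sum mult pth power tS)
  then show ?thesis by (simp add: S_def)
qed

text \<open>The change of variable from \<open>x\<close> to \<open>t\<close>, which makes the
  description in \<open>cartier\<close> unique: only the power \<open>x ^ (p - 1)\<close>
  contributes.\<close>

lemma C_expansion_mult_D: "C ((\<Sum>i<p. f i ^ p * x ^ i) * D x) = f (p - 1) * D x"
proof -
  have "C ((\<Sum>i<p. f i ^ p * x ^ i) * D x) = (\<Sum>i<p. f i * C (x ^ i * D x))"
    by (simp only: sum_distrib_right mult.assoc C_sum C_power_p_mult)
  also have "\<dots> = (\<Sum>i\<in>{p - 1}. f i * C (x ^ i * D x))"
    using p_minus_1_less by (intro sum.mono_neutral_right) (auto simp: C_power_mult_D_eq_0)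
  finally show ?thesis using C_power_mult_D[of x] by simp
qed

lemma P_C:
  assumes "P y = Fin (int p * r + int p - 1)"
  shows "P (C y) = Fin r"
proof -
  have "int (p - 1) = int p - 1"
    using of_nat_diff[of 1 p] p_gt_1 by (simp only: less_imp_le of_nat_1)
  then have "P (\<Sum>i<p. coord y i ^ p * t ^ i) = Fin (int p * r + int (p - 1))"
    unfolding expansion[of y, symmetric] assms by (simp only: add_diff_eq)
  then show ?thesis unfolding C_def using p_minus_1_less by (rule expansion_val)
qed

text \<open>The order p^(j+1) k - 1 equals p (p^j k - 1) + p - 1, the form required by
  \<open>P_C\<close>.\<close>

lemma P_funpow_C:
  assumes "P y = Fin (int p ^ j * k - 1)"
  shows "P ((C ^^ j) y) = Fin (k - 1)"
  using assms
proof (induction j arbitrary: y)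
  case (Suc j)
  have "P (C y) = Fin (int p ^ j * k - 1)"
    using Suc.prems by (intro P_C) (simp add: algebra_simps)
  then show ?case using Suc.IH by (simp add: funpow_Suc_right del: funpow.simps)
qed simp

text \<open>This compares two local parameters. In the expansion of \<open>s\<close> the coefficient
  at \<open>t\<close> has order 0, the term without \<open>t\<close> has derivative 0, and the terms
  with \<open>i \<ge> 2\<close> keep positive order after differentiation.\<close>

lemma P_D:
  assumes "P s = Fin 1"
  shows "P (D s) = Fin 0"
proof -
  have "P (\<Sum>i<p. coord s i ^ p * t ^ i) = Fin (int p * 0 + int 1)"
    unfolding expansion[of s, symmetric] assms by simp
  note val = expansion_val[OF this p_gt_1]
  let ?f = "\<lambda>i. of_nat i * (coord s i ^ p * t ^ (i - 1))"
  have 1: "P (?f 1) = Fin 0" using P_power[OF val(1), of p] by simp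
  have step: "Fin 1 \<le> P (?f i)" if i: "i < p" "i \<noteq> 1" for i
  proof (cases "of_nat i = (0 :: 'f) \<or> coord s i = 0")
    case False
    then have "i \<noteq> 0" by (intro notI) simp
    have "1 \<le> int p * val (coord s i) + int i"
      using val(2)[OF i(1)] False by (simp add: P_term)
    \<comment> \<open>Otherwise the term would have order at most \<open>i - p\<close>, which is
      negative.\<close>
    have "0 \<le> val (coord s i)"
    proof (rule ccontr)
      assume "\<not> 0 \<le> val (coord s i)"
      then have "int p * val (coord s i) \<le> int p * (- 1)" by (intro mult_left_mono) auto
      then show False using \<open>1 \<le> _\<close> i by simp
    qed
    then have "0 \<le> int p * val (coord s i)" by simp
    moreover have "P (of_nat i) = Fin 0" using False by (intro P_const) auto
    then have "P (?f i) = Fin (int p * val (coord s i) + int (i - 1))"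
      using False by (subst P_mult) (simp add: P_term)
    ultimately show ?thesis using i \<open>i \<noteq> 0\<close> by simp
  qed auto
  have ge: "Fin 1 \<le> P (\<Sum>i\<in>{..<p} - {1}. ?f i)"
    by (rule P_sum_ge, rule step) simp_all
  have lt: "P (?f 1) < P (\<Sum>i\<in>{..<p} - {1}. ?f i)"
    unfolding 1 by (rule less_le_trans[OF _ ge]) simp
  have "D s = ?f 1 + (\<Sum>i\<in>{..<p} - {1}. ?f i)"
    unfolding D_def by (rule sum.remove) (simp_all only: finite_lessThan lessThan_iff p_gt_1)
  then show ?thesis by (simp only: P_add_eq[OF lt] 1)
qed

end

section \<open>Differential forms\<close>

lemma fdiff_eq_iff_span:
  "fdiff K f x = fdiff K g y \<longleftrightarrow>
     Poly_Mapping.single x f - Poly_Mapping.single y g \<in> kaehler.span (kaehler_relations K)"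
proof -
  let ?S = "kaehler.span (kaehler_relations K)"
  have "kaehler_class K a = kaehler_class K b \<longleftrightarrow> a - b \<in> ?S" for a b
  proof
    assume "kaehler_class K a = kaehler_class K b"
    moreover have "a \<in> kaehler_class K a" by (simp add: kaehler_class_def kaehler.span_zero)
    ultimately show "a - b \<in> ?S" by (simp add: kaehler_class_def)
  next
    assume ab: "a - b \<in> ?S"
    have "c - a \<in> ?S \<longleftrightarrow> c - b \<in> ?S" for c
      using kaehler.span_add[OF _ ab, of "c - a"] kaehler.span_diff[OF _ ab, of "c - b"] by auto
    then show "kaehler_class K a = kaehler_class K b" by (simp add: kaehler_class_def)
  qed
  then show ?thesis by (simp add: fdiff_def)
qed

context local_parameter
begin

text \<open>The linear extension of dx \<mapsto> \<open>D x\<close> to the free space. It vanishes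
  on the relations because \<open>D\<close> is a derivation killing \<open>K\<close>, so it reads
  off the coefficient of dt of a form.\<close>

definition pairing :: "('f \<Rightarrow>\<^sub>0 'f) \<Rightarrow> 'f" where
  "pairing a = (\<Sum>x\<in>Poly_Mapping.keys a. Poly_Mapping.lookup a x * D x)"

lemma pairing_superset:
  "finite S \<Longrightarrow> Poly_Mapping.keys a \<subseteq> S \<Longrightarrow> pairing a = (\<Sum>x\<in>S. Poly_Mapping.lookup a x * D x)"
  unfolding pairing_def by (intro sum.mono_neutral_left) (auto simp: in_keys_iff)

lemma pairing_add: "pairing (a + b) = pairing a + pairing b"
proof -
  let ?S = "Poly_Mapping.keys a \<union> Poly_Mapping.keys b"
  have "Poly_Mapping.keys (a + b) \<subseteq> ?S" by (rule Poly_Mapping.keys_add)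
  then show ?thesis
    using pairing_superset[of ?S a] pairing_superset[of ?S b] pairing_superset[of ?S "a + b"]
    by (simp add: lookup_add distrib_right sum.distrib)
qed

lemma pairing_scale: "pairing (Poly_Mapping.map ((*) c) a) = c * pairing a"
proof -
  have "Poly_Mapping.keys (Poly_Mapping.map ((*) c) a) \<subseteq> Poly_Mapping.keys a"
    by (auto simp: in_keys_iff lookup_map_times)
  then show ?thesis
    using pairing_superset[of "Poly_Mapping.keys a" "Poly_Mapping.map ((*) c) a"]
    by (simp add: pairing_def lookup_map_times sum_distrib_left mult.assoc)
qed

lemma pairing_single [simp]: "pairing (Poly_Mapping.single x f) = f * D x"
  by (cases "f = 0") (simp_all add: pairing_def)

lemma pairing_diff: "pairing (a - b) = pairing a - pairing b"
  using pairing_add[of "a - b" b] by simp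

lemma pairing_span: "a \<in> kaehler.span (kaehler_relations K) \<Longrightarrow> pairing a = 0"
proof (induction rule: kaehler.span_induct)
  case base
  show ?case
    unfolding kaehler.subspace_def
    by (auto simp: pairing_add pairing_scale) (simp add: pairing_def)
next
  case (step a)
  then show ?case
    by (auto simp: kaehler_relations_def pairing_diff D_add D_mult D_const)
qed

text \<open>The elements \<open>y\<close> with dy = \<open>D y\<close> dt are closed under sums and
  products and contain \<open>K\<close>, \<open>t\<close> and all \<open>p\<close>-th powers; by
  \<open>expansion\<close> they are everything.\<close>

lemma single_D_in_span:
  "Poly_Mapping.single y 1 - Poly_Mapping.single t (D y) \<in> kaehler.span (kaehler_relations K)"
proof -
  let ?S = "kaehler.span (kaehler_relations K)"
  let ?s = "Poly_Mapping.single :: 'f \<Rightarrow> 'f \<Rightarrow> _"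
  have rel_add: "?s (x + y) 1 - ?s x 1 - ?s y 1 \<in> ?S"
    and rel_mult: "?s (x * y) 1 - ?s y x - ?s x y \<in> ?S" for x y
    by (rule kaehler.span_base; auto simp: kaehler_relations_def)+
  have rel_const: "?s c 1 \<in> ?S" if "c \<in> K" for c
    by (rule kaehler.span_base) (use that in \<open>auto simp: kaehler_relations_def\<close>)
  define W where "W = {y. ?s y 1 - ?s t (D y) \<in> ?S}"
  have add: "x + y \<in> W" if "x \<in> W" "y \<in> W" for x y
  proof -
    have "?s (x + y) 1 - ?s t (D (x + y)) =
        (?s (x + y) 1 - ?s x 1 - ?s y 1) + ((?s x 1 - ?s t (D x)) + (?s y 1 - ?s t (D y)))"
      by (simp add: D_add single_add)
    also have "\<dots> \<in> ?S"
      using that rel_add unfolding W_def by (intro kaehler.span_add) auto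
    finally show ?thesis by (simp add: W_def)
  qed
  have mult: "x * y \<in> W" if "x \<in> W" "y \<in> W" for x y
  proof -
    have x: "?s x y - ?s t (y * D x) \<in> ?S" and y: "?s y x - ?s t (x * D y) \<in> ?S"
      using that kaehler.span_scale[of "?s x 1 - ?s t (D x)" _ y]
        kaehler.span_scale[of "?s y 1 - ?s t (D y)" _ x]
      by (simp_all add: W_def kaehler.scale_right_diff_distrib)
    have "?s (x * y) 1 - ?s t (D (x * y)) =
        (?s (x * y) 1 - ?s y x - ?s x y) + ((?s x y - ?s t (y * D x)) + (?s y x - ?s t (x * D y)))"
      by (simp add: D_mult single_add)
    also have "\<dots> \<in> ?S"
      using x y rel_mult by (intro kaehler.span_add)
    finally show ?thesis by (simp add: W_def)
  qed
  have const: "c \<in> W" if "c \<in> K" for c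
    using rel_const[OF that] that by (simp add: W_def D_const)
  have tW: "t \<in> W" by (simp add: W_def kaehler.span_zero)
  have power: "x ^ n \<in> W" if "x \<in> W" for x n
    by (induction n) (use const[of 1] mult that in auto)
  have pth: "a ^ p \<in> W" for a
  proof -
    \<comment> \<open>The power rule for the universal derivation; at \<open>n = p\<close> its
      factor vanishes.\<close>
    have "?s (a ^ n) 1 - ?s a (of_nat n * a ^ (n - 1)) \<in> ?S" for n
    proof (induction n)
      case (Suc n)
      have *: "?s (a ^ n) a - ?s a (of_nat n * a ^ n) \<in> ?S"
        using kaehler.span_scale[OF Suc, of a]
        by (cases n) (simp_all add: kaehler.scale_right_diff_distrib mult_ac)
      have "?s (a ^ Suc n) 1 - ?s a (of_nat (Suc n) * a ^ (Suc n - 1)) =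
          (?s (a * a ^ n) 1 - ?s (a ^ n) a - ?s a (a ^ n)) +
          (?s (a ^ n) a - ?s a (of_nat n * a ^ n))"
        by (simp add: algebra_simps single_add)
      also have "\<dots> \<in> ?S" by (intro kaehler.span_add rel_mult *)
      finally show ?case .
    qed (use rel_const[of 1] in simp)
    from this[of p] have "?s (a ^ p) 1 \<in> ?S"
      using of_nat_CHAR[where 'a = 'f] by (simp add: CHAR)
    then show ?thesis by (simp add: W_def)
  qed
  have sum: "sum f A \<in> W" if "\<And>i. i \<in> A \<Longrightarrow> f i \<in> W" for f :: "nat \<Rightarrow> 'f" and A
    using that by (induction A rule: infinite_finite_induct) (auto intro: const add)
  have "y \<in> W"
    by (subst expansion) (intro sum mult pth power tW)
  then show ?thesis by (simp add: W_def)
qed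

lemma fdiff_eq_fdiff_t: "fdiff K f x = fdiff K (f * D x) t"
  unfolding fdiff_eq_iff_span
  using kaehler.span_scale[OF single_D_in_span, of f x]
  by (simp add: kaehler.scale_right_diff_distrib)

text \<open>\<open>pairing\<close> gives one direction, rewriting both forms as multiples of dt the
  other.\<close>

lemma fdiff_eq_iff: "fdiff K f x = fdiff K g y \<longleftrightarrow> f * D x = g * D y"
proof
  assume "fdiff K f x = fdiff K g y"
  then show "f * D x = g * D y"
    unfolding fdiff_eq_iff_span by (auto dest!: pairing_span simp: pairing_diff)
next
  assume "f * D x = g * D y"
  then show "fdiff K f x = fdiff K g y"
    using fdiff_eq_fdiff_t[of f x] fdiff_eq_fdiff_t[of g y] by simp
qed

lemma differential_eq_fdiff:
  assumes "\<omega> \<in> differentials K"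
  obtains f where "\<omega> = fdiff K f t"
proof -
  let ?S = "kaehler.span (kaehler_relations K)"
  obtain a where a: "\<omega> = kaehler_class K a" using assms by (auto simp: differentials_def)
  have "\<exists>f. a - Poly_Mapping.single t f \<in> ?S"
  proof (induction a rule: Poly_Mapping.update_induct)
    case const
    then show ?case by (intro exI[of _ 0]) (simp add: kaehler.span_zero)
  next
    case (update a x c)
    then obtain f where f: "a - Poly_Mapping.single t f \<in> ?S" by blast
    have "Poly_Mapping.update x c a = a + Poly_Mapping.single x c"
      using update by (intro poly_mapping_eqI)
        (auto simp: lookup_update lookup_add lookup_single in_keys_iff when_def)
    then have "Poly_Mapping.update x c a - Poly_Mapping.single t (f + c * D x) =
        (a - Poly_Mapping.single t f) + (Poly_Mapping.single x c - Poly_Mapping.single t (c * D x))"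
      by (simp add: single_add)
    also have "\<dots> \<in> ?S"
      using f fdiff_eq_fdiff_t[of c x] unfolding fdiff_eq_iff_span by (rule kaehler.span_add)
    finally show ?case by blast
  qed
  then obtain f where f: "a - Poly_Mapping.single t f \<in> ?S" by blast
  have "b - a \<in> ?S \<longleftrightarrow> b - Poly_Mapping.single t f \<in> ?S" for b
    using kaehler.span_add[OF _ f, of "b - a"]
      kaehler.span_diff[OF _ f, of "b - Poly_Mapping.single t f"] by auto
  then have "\<omega> = fdiff K f t" by (simp add: a fdiff_def kaehler_class_def)
  then show thesis by (rule that)
qed

section \<open>Orders and Cartier images of forms\<close>

text \<open>Passing to another parameter \<open>s\<close> changes the coefficient by
  \<open>D s\<close>, which has order 0.\<close>

lemma diff_val_fdiff_t: "diff_val K P (fdiff K f t) = P f"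
  unfolding diff_val_def
proof (rule the_equality)
  show "\<exists>g s. P s = Fin 1 \<and> fdiff K f t = fdiff K g s \<and> P f = P g"
    using t by blast
  fix n assume "\<exists>g s. P s = Fin 1 \<and> fdiff K f t = fdiff K g s \<and> n = P g"
  then obtain g s where s: "P s = Fin 1" "fdiff K f t = fdiff K g s" "n = P g" by blast
  then have "f = g * D s" by (simp add: fdiff_eq_iff)
  then have "P f = P g + Fin 0" using P_D[OF s(1)] by (simp add: P_mult)
  then show "n = P f" using s(3) by (cases "P g") auto
qed

text \<open>Existence uses \<open>t\<close> itself as separating element; uniqueness is
  \<open>C_expansion_mult_D\<close>.\<close>

lemma cartier_fdiff_t: "cartier K p (fdiff K f t) = fdiff K (C f) t"
  unfolding cartier_def
proof (rule the_equality)
  show "\<exists>x g. separating K x \<and> fdiff K f t = fdiff K (\<Sum>i<p. g i ^ p * x ^ i) x \<and>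
      fdiff K (C f) t = fdiff K (g (p - 1)) x"
    unfolding C_def
    by (intro exI[of _ t] exI[of _ "coord f"]) (simp add: separating_t flip: expansion)
  fix \<eta> assume "\<exists>x g. separating K x \<and> fdiff K f t = fdiff K (\<Sum>i<p. g i ^ p * x ^ i) x \<and>
      \<eta> = fdiff K (g (p - 1)) x"
  then obtain x g where x: "fdiff K f t = fdiff K (\<Sum>i<p. g i ^ p * x ^ i) x"
    "\<eta> = fdiff K (g (p - 1)) x" by blast
  then have "f = (\<Sum>i<p. g i ^ p * x ^ i) * D x" by (simp add: fdiff_eq_iff)
  then have "C f = g (p - 1) * D x" by (simp only: C_expansion_mult_D)
  then show "\<eta> = fdiff K (C f) t" using x(2) fdiff_eq_fdiff_t[of "g (p - 1)" x] by simp
qed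

lemma funpow_cartier_fdiff_t: "(cartier K p ^^ j) (fdiff K f t) = fdiff K ((C ^^ j) f) t"
  by (induction j) (simp_all add: cartier_fdiff_t)

lemma cartier_invariant_diff_val:
  assumes \<omega>: "\<omega> \<in> differentials K" and fixed: "(cartier K p ^^ m) \<omega> = \<omega>" and "1 \<le> m"
    and ge: "Fin n \<le> diff_val K P \<omega>" and n: "0 \<le> n" "[n = int (p ^ m) - 1] (mod int (p ^ m))"
  shows "Fin (n + 1) \<le> diff_val K P \<omega>"
proof -
  obtain f where f: "\<omega> = fdiff K f t" using differential_eq_fdiff[OF \<omega>] by blast
  have fix_f: "(C ^^ m) f = f"
    using fixed by (simp add: f funpow_cartier_fdiff_t fdiff_eq_iff)
  have "[n + 1 = int (p ^ m) - 1 + 1] (mod int (p ^ m))" using n(2) by (rule cong_add) simp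
  then have "int (p ^ m) dvd n + 1" by (simp add: cong_def mod_eq_0_iff_dvd)
  then obtain k where k: "n + 1 = int p ^ m * k" by auto
  \<comment> \<open>Order \<open>n\<close> would force \<open>n = k - 1\<close>, so
    \<open>k = p ^ m * k\<close> with \<open>k = n + 1\<close> positive.\<close>
  have "P f \<noteq> Fin n"
  proof
    assume "P f = Fin n"
    then have "P ((C ^^ m) f) = Fin (k - 1)"
      using k by (intro P_funpow_C) (simp flip: k)
    then have "n + 1 = k" using fix_f \<open>P f = Fin n\<close> by simp
    moreover have "1 < int p ^ m" using p_gt_1 \<open>1 \<le> m\<close> by (intro one_less_power) auto
    ultimately show False using k n(1) by simp
  qed
  then show ?thesis using ge by (cases "P f") (auto simp: f diff_val_fdiff_t)
qed

end

section \<open>Function fields over finite fields\<close>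

text \<open>The shift by 1 permutes \<open>K\<close>, so it leaves the sum of all elements
  unchanged.\<close>

lemma of_nat_card_subfield:
  fixes K :: "'f::field set"
  assumes "is_subfield K" "finite K"
  shows "of_nat (card K) = (0 :: 'f)"
proof -
  interpret subfield K by unfold_locales fact
  have "bij_betw (\<lambda>c. c + 1) K K"
    by (rule bij_betw_byWitness[where f' = "\<lambda>c. c - 1"]) auto
  then have "(\<Sum>c\<in>K. c + 1) = (\<Sum>c\<in>K. c)" by (rule sum.reindex_bij_betw)
  then show ?thesis by (simp add: sum.distrib)
qed

lemma CHAR_of_finite_subfield:
  fixes K :: "'f::field set"
  assumes "is_subfield K" "card K = p ^ n" "prime p"
  shows "CHAR('f) = p"
proof -
  have "finite K" using assms by (intro card_ge_0_finite) (simp add: prime_gt_0_nat)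
  then have "(of_nat p :: 'f) ^ n = 0" using of_nat_card_subfield[OF assms(1)] assms(2) by simp
  then have "of_nat p = (0 :: 'f)" by simp
  then have "CHAR('f) dvd p" by (simp add: of_nat_eq_0_iff_char_dvd)
  moreover have "CHAR('f) \<noteq> 1" by simp
  ultimately show ?thesis using assms(3) unfolding prime_nat_iff by blast
qed

text \<open>The Frobenius map is injective, hence surjective on a finite set.\<close>

lemma finite_subfield_perfect:
  fixes K :: "'f::field set"
  assumes "is_subfield K" "finite K" "prime CHAR('f)" "c \<in> K"
  shows "\<exists>d\<in>K. c = d ^ CHAR('f)"
proof -
  interpret subfield K by unfold_locales fact
  have "inj_on (\<lambda>a. a ^ CHAR('f)) K"
  proof (rule inj_onI)
    fix a b :: 'f assume "a ^ CHAR('f) = b ^ CHAR('f)"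
    then have "(a - b) ^ CHAR('f) = 0" using diff_power_CHAR[OF assms(3), of a b] by simp
    then show "a = b" by simp
  qed
  then have "(\<lambda>a. a ^ CHAR('f)) ` K = K"
    using assms(2) by (intro endo_inj_surj) auto
  then show ?thesis using assms(4) by blast
qed

text \<open>Hence the places in \<open>upper_divisor\<close> lie in the support of \<open>G\<close>:
  they are finitely many and avoid that of the evaluation divisor.\<close>

lemma not_cong_modulus_minus_1:
  assumes "1 < q"
  shows "\<not> [0 = int q - 1] (mod int q)"
proof
  assume "[0 = int q - 1] (mod int q)"
  moreover have "(int q - 1) mod int q = int q - 1"
    using assms by (intro mod_pos_pos_trivial) auto
  ultimately have "int q - 1 = 0" by (simp only: cong_def mod_0)
  then show False using assms by simp
qed

text \<open>Finiteness of the index set matters, since a sum over an infinite set would take the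
  default value 0.\<close>

lemma lookup_upper_divisor:
  assumes "1 < q"
  shows "Poly_Mapping.lookup (upper_divisor K q G) P =
    (if P \<in> places K \<and> 0 \<le> Poly_Mapping.lookup G P \<and>
        [Poly_Mapping.lookup G P = int q - 1] (mod int q) then 1 else 0)"
proof -
  let ?S = "{P \<in> places K. 0 \<le> Poly_Mapping.lookup G P \<and>
     [Poly_Mapping.lookup G P = int q - 1] (mod int q)}"
  have "?S \<subseteq> Poly_Mapping.keys G"
    using not_cong_modulus_minus_1[OF assms] by (auto simp: in_keys_iff)
  then have "finite ?S" by (rule finite_subset) simp
  then show ?thesis by (simp add: upper_divisor_def lookup_sum lookup_single when_def sum.delta)
qed

theorem theorem4p4:
  fixes K :: "'f::field set" and p m q l :: nat
    and Ps :: "'f place list" and G :: "'f divisor"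
  assumes "prime p" and "m \<ge> 1" and "q = p ^ m" and "l \<ge> 1"
    and "function_field K" and "card K = q ^ l"
    and "distinct Ps" and "set Ps \<subseteq> rational_places K"
    and "G \<in> divisors K"
    and "Poly_Mapping.keys G \<inter> Poly_Mapping.keys (divisor_of_places Ps) = {}"
  shows "cartier_code K p m Ps G = cartier_code K p m Ps (G + upper_divisor K q G)"
proof -
  have q: "1 < q" using one_less_power[OF prime_gt_1_nat[OF assms(1)], of m] assms(2,3) by simp
  have sub: "is_subfield K" using assms(5) by (simp add: function_field_def)
  have fin: "finite K" using assms(6) q by (intro card_ge_0_finite) simp
  have char: "CHAR('f) = p"
    using CHAR_of_finite_subfield[OF sub, of p "m * l"] assms(1,3,6) by (simp add: power_mult)
  let ?D = "divisor_of_places Ps" and ?U = "upper_divisor K q G"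
  \<comment> \<open>For fixed forms the two order conditions agree, so both codes take residues of
    the same forms.\<close>
  have "\<omega> \<in> Omega K (G - ?D) \<longleftrightarrow> \<omega> \<in> Omega K (G + ?U - ?D)"
    if fixed: "(cartier K p ^^ m) \<omega> = \<omega>" for \<omega>
  proof
    assume "\<omega> \<in> Omega K (G + ?U - ?D)"
    \<comment> \<open>The added divisor is effective, so it only strengthens the condition.\<close>
    moreover have "Fin (Poly_Mapping.lookup (G - ?D) P) \<le> Fin (Poly_Mapping.lookup (G + ?U - ?D) P)" for P
      by (simp add: lookup_minus lookup_add lookup_upper_divisor[OF q])
    ultimately show "\<omega> \<in> Omega K (G - ?D)" unfolding Omega_def by (blast intro: order_trans)
  next
    assume \<omega>: "\<omega> \<in> Omega K (G - ?D)"
    have "Fin (Poly_Mapping.lookup (G + ?U - ?D) P) \<le> diff_val K P \<omega>" if P: "P \<in> places K" for P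
    proof -
      let ?n = "Poly_Mapping.lookup G P"
      have ge: "Fin (Poly_Mapping.lookup (G - ?D) P) \<le> diff_val K P \<omega>" using \<omega> P by (simp add: Omega_def)
      show ?thesis
      proof (cases "0 \<le> ?n \<and> [?n = int q - 1] (mod int q)")
        case False
        then show ?thesis using ge by (auto simp: lookup_minus lookup_add lookup_upper_divisor[OF q])
      next
        case True
        \<comment> \<open>The place lies in the support of \<open>G\<close>, so \<open>?D\<close>
          does not lower the bound there.\<close>
        then have "?n \<noteq> 0" using not_cong_modulus_minus_1[OF q] by auto
        then have D: "Poly_Mapping.lookup ?D P = 0" using assms(10) by (auto simp: in_keys_iff)
        obtain t where t: "P t = Fin 1" using P by (auto simp: places_def)
        interpret local_parameter K P t p
          using sub P t assms(1,5) char finite_subfield_perfect[OF sub fin]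
          by unfold_locales auto
        have "Fin (?n + 1) \<le> diff_val K P \<omega>"
          using \<omega> fixed assms(2,3) True ge D
          by (intro cartier_invariant_diff_val[of \<omega> m]) (auto simp: Omega_def lookup_minus)
        then show ?thesis using True P D by (simp add: lookup_minus lookup_add lookup_upper_divisor[OF q])
      qed
    qed
    then show "\<omega> \<in> Omega K (G + ?U - ?D)" using \<omega> by (simp add: Omega_def)
  qed
  then show ?thesis unfolding cartier_code_def by blast
qed

end
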